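(* Let $\mu_0\in\mathcal P(\mathbb R^{d_0})$, $\mu_1\in\mathcal P(\mathbb R^{d_1})$ be compactly supported, let $\varepsilon>0$, and let $\Phi(A)=32\|A\|_F^2+\mathrm{OT}_{A,\varepsilon}(\mu_0,\mu_1)$ for $A\in\mathbb R^{d_0\times d_1}$. The map $\Phi$ is weakly convex with parameter at most $32^2\varepsilon^{-1}\sqrt{M_4(\mu_0)M_4(\mu_1)}-64$ and, if $\sqrt{M_4(\mu_0)M_4(\mu_1)}<\frac{\varepsilon}{16}$, then it is strictly convex and admits a unique minimizer. Moreover, for any $M>0$, $\Phi$ is $L$-smooth on $\mathcal D_M$ with \[L=\max_{A\in\mathcal D_M}\ \lambda_{\max}\left(D^2\Phi_{[A]}\right)\vee\left(-\lambda_{\min}\left(D^2\Phi_{[A]}\right)\right)\ \le\ 64\vee\left(32^2\varepsilon^{-1}\sqrt{M_4(\mu_0)M_4(\mu_1)}-64\right).\]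
   Context: $\Pi(\mu_0,\mu_1)$ is the set of couplings; $\mathsf D_{\mathsf{KL}}$ is the Kullback–Leibler divergence; $\|\cdot\|_F$ is the Frobenius norm; $M_p(\mu)=\int\|x\|^p d\mu(x)$; $a\vee b=\max\{a,b\}$; $\mathcal D_M=\{A\in\mathbb R^{d_0\times d_1}:\|A\|_F\le M/2\}$. For $A\in\mathbb R^{d_0\times d_1}$, $c_A(x,y)=-4\|x\|^2\|y\|^2-32x^{\intercal}Ay$ and \[\mathrm{OT}_{A,\varepsilon}(\mu_0,\mu_1)=\inf_{\pi\in\Pi(\mu_0,\mu_1)}\int c_A\,d\pi+\varepsilon\,\mathsf D_{\mathsf{KL}}(\pi\|\mu_0\otimes\mu_1).\] A function $f$ is $\rho$-weakly convex if $f+\frac{\rho}{2}\|\cdot\|^2$ is convex (here with the Frobenius norm); it is $L$-smooth (on a set) if its gradient is $L$-Lipschitz (on that set). $\Phi$ is smooth, and its second Fréchet derivative $D^2\Phi_{[A]}$, a symmetric bilinear form on $\mathbb R^{d_0\times d_1}$ with the Frobenius inner product, is identified with a $d_0d_1\times d_0d_1$ symmetric matrix; $\lambda_{\max},\lambda_{\min}$ are its largest and smallest eigenvalues. *)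

theory Defs
  imports "HOL-Probability.Probability"
begin

definition borel_probability :: "'a::topological_space measure \<Rightarrow> bool" where
  "borel_probability \<mu> \<longleftrightarrow> prob_space \<mu> \<and> sets \<mu> = sets borel"

definition measure_supp :: "'a::topological_space measure \<Rightarrow> 'a set" where
  "measure_supp \<mu> = {x. \<forall>U. open U \<and> x \<in> U \<longrightarrow> emeasure \<mu> U > 0}"

definition compactly_supported :: "'a::topological_space measure \<Rightarrow> bool" where
  "compactly_supported \<mu> \<longleftrightarrow> compact (measure_supp \<mu>)"

definition abs_moment :: "nat \<Rightarrow> 'a::real_normed_vector measure \<Rightarrow> real" where
  "abs_moment p \<mu> = (\<integral>x. norm x ^ p \<partial>\<mu>)"

definition couplings :: "'a measure \<Rightarrow> 'b measure \<Rightarrow> ('a \<times> 'b) measure set" where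
  "couplings \<mu> \<nu> = {\<pi>. sets \<pi> = sets (\<mu> \<Otimes>\<^sub>M \<nu>) \<and> distr \<pi> \<mu> fst = \<mu> \<and> distr \<pi> \<nu> snd = \<nu>}"

text \<open>The Kullback--Leibler divergence of \<open>P\<close> from \<open>Q\<close>, with values in the extended reals. The
  library's \<^const>\<open>KL_divergence\<close> has the reference measure as its first measure argument and is
  real valued. The negative part of \<open>ln (dP/dQ)\<close> is always \<open>P\<close>-integrable for probability measures,
  so non-integrability means that the integral is \<open>+\<infinity>\<close>.\<close>

definition KL_ext :: "'a measure \<Rightarrow> 'a measure \<Rightarrow> ereal" where
  "KL_ext P Q =
    (if absolutely_continuous Q P \<and> integrable P (entropy_density (exp 1) Q P)
     then ereal (KL_divergence (exp 1) Q P) else \<infinity>)"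

text \<open>A matrix in \<open>\<real>\<^bsup>d\<^sub>0 \<times> d\<^sub>1\<^esup>\<close> has type \<open>real ^ 'd1 ^ 'd0\<close>. The norm and the inner product of this type
  are the Frobenius norm and inner product.\<close>

definition cost :: "real ^ 'd1 ^ 'd0 \<Rightarrow> (real ^ 'd0) \<times> (real ^ 'd1) \<Rightarrow> real" where
  "cost A = (\<lambda>(x, y). - 4 * (norm x)\<^sup>2 * (norm y)\<^sup>2 - 32 * (x \<bullet> (A *v y)))"

definition entropic_OT ::
  "real \<Rightarrow> (real ^ 'd0) measure \<Rightarrow> (real ^ 'd1) measure \<Rightarrow> real ^ 'd1 ^ 'd0 \<Rightarrow> ereal" where
  "entropic_OT \<epsilon> \<mu>0 \<mu>1 A =
    (INF \<pi>\<in>couplings \<mu>0 \<mu>1. ereal (\<integral>z. cost A z \<partial>\<pi>) + ereal \<epsilon> * KL_ext \<pi> (\<mu>0 \<Otimes>\<^sub>M \<mu>1))"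

definition Phi ::
  "real \<Rightarrow> (real ^ 'd0) measure \<Rightarrow> (real ^ 'd1) measure \<Rightarrow> real ^ 'd1 ^ 'd0 \<Rightarrow> real" where
  "Phi \<epsilon> \<mu>0 \<mu>1 A = 32 * (norm A)\<^sup>2 + real_of_ereal (entropic_OT \<epsilon> \<mu>0 \<mu>1 A)"

text \<open>The parameter \<open>\<rho>\<close> may be negative, in which case the function is strongly convex.\<close>

definition weakly_convex :: "real \<Rightarrow> ('a::real_normed_vector \<Rightarrow> real) \<Rightarrow> bool" where
  "weakly_convex \<rho> f \<longleftrightarrow> convex_on UNIV (\<lambda>x. f x + \<rho> / 2 * (norm x)\<^sup>2)"

definition strictly_convex :: "('a::real_vector \<Rightarrow> real) \<Rightarrow> bool" where
  "strictly_convex f \<longleftrightarrow>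
    (\<forall>x y t. x \<noteq> y \<and> 0 < t \<and> t < 1 \<longrightarrow>
      f ((1 - t) *\<^sub>R x + t *\<^sub>R y) < (1 - t) * f x + t * f y)"

definition L_smooth_on :: "real \<Rightarrow> 'a::real_inner set \<Rightarrow> ('a \<Rightarrow> real) \<Rightarrow> bool" where
  "L_smooth_on L S f \<longleftrightarrow> (\<exists>g. (\<forall>x\<in>S. GDERIV f x :> g x) \<and> L-lipschitz_on S g)"

definition frechet_D :: "('a::real_normed_vector \<Rightarrow> real) \<Rightarrow> 'a \<Rightarrow> 'a \<Rightarrow>\<^sub>L real" where
  "frechet_D f x = Blinfun (frechet_derivative f (at x))"

definition frechet_D2 :: "('a::real_normed_vector \<Rightarrow> real) \<Rightarrow> 'a \<Rightarrow> 'a \<Rightarrow> 'a \<Rightarrow> real" where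
  "frechet_D2 f x v w = blinfun_apply (frechet_derivative (frechet_D f) (at x) v) w"

definition twice_frechet_differentiable_at ::
  "('a::real_normed_vector \<Rightarrow> real) \<Rightarrow> 'a \<Rightarrow> bool" where
  "twice_frechet_differentiable_at f x \<longleftrightarrow>
    (\<forall>\<^sub>F y in nhds x. f differentiable (at y)) \<and> frechet_D f differentiable (at x)"

definition unit_matrix :: "'m \<times> 'n \<Rightarrow> real ^ 'n ^ 'm" where
  "unit_matrix p = axis (fst p) (axis (snd p) 1)"

text \<open>The matrix of the second derivative with respect to the orthonormal basis of unit matrices.\<close>

definition hessian ::
  "(real ^ 'n ^ 'm \<Rightarrow> real) \<Rightarrow> real ^ 'n ^ 'm \<Rightarrow> real ^ ('m \<times> 'n) ^ ('m \<times> 'n)" where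
  "hessian f A = (\<chi> p q. frechet_D2 f A (unit_matrix p) (unit_matrix q))"

definition eigenvalues :: "real ^ 'k ^ 'k \<Rightarrow> real set" where
  "eigenvalues H = {l. \<exists>v. v \<noteq> 0 \<and> H *v v = l *\<^sub>R v}"

definition lambda_max :: "real ^ 'k ^ 'k \<Rightarrow> real" where
  "lambda_max H = Max (eigenvalues H)"

definition lambda_min :: "real ^ 'k ^ 'k \<Rightarrow> real" where
  "lambda_min H = Min (eigenvalues H)"

definition D_ball :: "real \<Rightarrow> (real ^ 'd1 ^ 'd0) set" where
  "D_ball M = {A. norm A \<le> M / 2}"

end

theory Submission
  imports Defs
begin

text \<open>Write the cost as \<open>- \<epsilon> f\<close> and let \<open>G f\<close> be the largest value of \<open>\<integral> f d\<pi> - KL(\<pi>)\<close> over couplings, so that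
  the transport cost is \<open>- \<epsilon> G f\<close> and \<open>f\<close> depends affinely on the matrix. On bounded continuous functions, a
  Sinkhorn step, corrected by a multiple of the mean (Doeblin's argument), is a contraction for the
  supremum norm. Its fixed point gives the Schroedinger potentials \<open>\<phi>\<close>, \<open>\<psi>\<close> and the optimal density
  \<open>p = exp (f - \<phi> - \<psi>)\<close>, and the contraction makes them differentiable in \<open>f\<close>. Hence \<open>G\<close> is twice
  continuously differentiable with \<open>DG[F] = \<integral> F p\<close> and \<open>D\<^sup>2G[F, F] = \<integral> w\<^sup>2 p\<close>, where \<open>w\<close> is the residual of the
  \<open>L\<^sup>2(p)\<close>-projection of \<open>F\<close> onto the sums \<open>u(x) + v(y)\<close>; so \<open>0 \<le> D\<^sup>2G[F, F] \<le> \<integral> F\<^sup>2 p\<close>, and the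
  Cauchy--Schwarz inequality bounds the last integral by the fourth moments.\<close>

section \<open>Fixed points of parametrized contractions\<close>

text \<open>The Sinkhorn step commutes with adding a constant to the potential, so on its own it
  contracts only modulo constants. Subtracting \<open>\<delta> *\<^sub>R E \<phi>\<close> shrinks
  the constants as well, and no quotient space is needed. The fixed point turns out to have mean
  zero, so it does not depend on \<delta>. This freedom matters because the \<delta> used here,
  \<open>exp (- 10 * r)\<close> for \<open>norm f \<le> r\<close>, shrinks with the size of the
  cost; differentiability is local and needs a single \<delta> near each \<open>f\<close> only. The
  averages over the two marginals enter as commuting positive operators, and measure theory is
  confined to Fubini's theorem and the variational principle. In the final bounds, 64 is the second
  derivative of \<open>32 * (norm A)\<^sup>2\<close>, \<open>32\<^sup>2 / \<epsilon>\<close> is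
  \<epsilon> times the square of the slope \<open>32 / \<epsilon>\<close> of \<open>f\<close> in the
  matrix, and \<open>\<epsilon> / 16\<close> is the value of the moment term at which the two
  balance.\<close>

text \<open>An implicit function theorem for fixed points: differentiating the equation gives the
  linear equation that determines \<open>D\<close>. Contraction is asked for only between
  \<open>\<phi> x\<close> and \<open>\<phi> p\<close>, because the map it is applied to is shown to
  contract only among functions of bounded oscillation.\<close>

lemma fixpoint_has_derivative:
  fixes T :: "'p::real_normed_vector \<times> 'e::banach \<Rightarrow> 'e" and \<phi> :: "'p \<Rightarrow> 'e"
  assumes U: "open U" "p \<in> U" and fp: "\<And>x. x \<in> U \<Longrightarrow> T (x, \<phi> x) = \<phi> x"
    and der: "(T has_derivative T') (at (p, \<phi> p))"
    and contr: "\<And>x. x \<in> U \<Longrightarrow> norm (T (x, \<phi> x) - T (x, \<phi> p)) \<le> q * norm (\<phi> x - \<phi> p)"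
    and q: "0 \<le> q" "q < 1" and lin: "\<And>h. norm (T' (0, h)) \<le> q * norm h"
  obtains D where "(\<phi> has_derivative D) (at p)" "\<And>H. D H = T' (H, D H)"
proof -
  interpret T': bounded_linear T' using der by (rule has_derivative_bounded_linear)
  have split: "T' (a, b) = T' (a, 0) + T' (0, b)" for a b
    using T'.add[of "(a,0)" "(0,b)"] by simp
  \<comment> \<open>Banach's theorem solves the linear equation for each \<open>H\<close>;
    additivity and homogeneity of \<open>D\<close> then follow from uniqueness.\<close>
  have ex1: "\<exists>!h. T' (H, h) = h" for H
  proof (rule banach_fix_type[OF q])
    show "\<forall>x y. dist (T' (H, x)) (T' (H, y)) \<le> q * dist x y"
      using lin T'.diff[of "(H,_)" "(H,_)"] by (simp add: dist_norm flip: T'.diff)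
  qed
  define D where "D H = (THE h. T' (H, h) = h)" for H
  have D: "T' (H, D H) = D H" for H
    unfolding D_def by (rule theI'[OF ex1])
  have Duniq: "T' (H, h) = h \<Longrightarrow> h = D H" for H h
    using ex1 D by blast
  obtain K where K: "\<And>x. norm (T' x) \<le> norm x * K" using T'.bounded by blast
  have Dbound: "norm (D H) \<le> norm H * (K / (1 - q))" for H
  proof -
    have "norm (D H) = norm (T' (H, 0) + T' (0, D H))" using D split by metis
    also have "\<dots> \<le> norm H * K + q * norm (D H)"
      using K[of "(H,0)"] lin[of "D H"] by (smt (verit) norm_Pair norm_triangle_ineq norm_zero
         power_zero_numeral real_sqrt_abs add.right_neutral abs_norm_cancel)
    finally have "(1 - q) * norm (D H) \<le> norm H * K" by (simp add: algebra_simps)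
    then show ?thesis using q by (simp add: field_simps)
  qed
  have Dlin: "bounded_linear D"
  proof (rule bounded_linear_intro[OF _ _ Dbound])
    show "D (x + y) = D x + D y" for x y
      using Duniq[of "x + y" "D x + D y"] T'.add[of "(x, D x)" "(y, D y)"] D by simp
    show "D (r *\<^sub>R x) = r *\<^sub>R D x" for r x
      using Duniq[of "r *\<^sub>R x" "r *\<^sub>R D x"] T'.scaleR[of r "(x, D x)"] D by simp
  qed
  interpret D: bounded_linear D by (rule Dlin)
  have der': "\<And>e. e > 0 \<Longrightarrow> \<exists>d>0. \<forall>y. norm (y - (p, \<phi> p)) < d \<longrightarrow>
      norm (T y - T (p, \<phi> p) - T' (y - (p, \<phi> p))) \<le> e * norm (y - (p, \<phi> p))"
    using der unfolding has_derivative_at_alt by blast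
  have nP: "norm (a, b) \<le> norm a + norm b" for a :: 'p and b :: 'e by (rule norm_Pair_le)
  have n0: "norm (a, 0::'e) = norm a" for a :: 'p by (simp add: norm_Pair)
  \<comment> \<open>A Lipschitz constant for \<open>\<phi>\<close> at \<open>p\<close>:
    \<open>\<bar>K\<bar> + 1\<close> bounds the growth of \<open>T (_, \<phi> p)\<close>, the 1
    being the error allowed in differentiability, and \<open>1 - q\<close> absorbs the change in the
    second argument.\<close>
  define C where "C = (\<bar>K\<bar> + 1) / (1 - q)"
  have C: "C > 0" using q by (simp add: C_def)
  obtain d1 where d1: "d1 > 0" and lip: "\<And>x. norm (x - p) < d1 \<Longrightarrow> x \<in> U \<and> norm (\<phi> x - \<phi> p) \<le> C * norm (x - p)"
  proof -
    obtain d where d: "d > 0" "\<And>y. norm (y - (p, \<phi> p)) < d \<Longrightarrow>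
      norm (T y - T (p, \<phi> p) - T' (y - (p, \<phi> p))) \<le> 1 * norm (y - (p, \<phi> p))"
      using der'[of 1] by auto
    obtain u where u: "u > 0" "ball p u \<subseteq> U" using U openE by blast
    show ?thesis
    proof (rule that[of "min d u"])
      fix x assume x: "norm (x - p) < min d u"
      have xU: "x \<in> U" using x u by (auto simp: dist_norm norm_minus_commute subset_eq)
      have "norm (T (x, \<phi> p) - T (p, \<phi> p) - T' (x - p, 0)) \<le> norm (x - p)"
        using d(2)[of "(x, \<phi> p)"] x by (simp add: n0)
      moreover have "norm (T' (x - p, 0)) \<le> \<bar>K\<bar> * norm (x - p)"
        using K[of "(x - p, 0)"] by (simp add: n0) (smt (verit) mult.commute mult_left_mono norm_ge_zero)
      ultimately have 1: "norm (T (x, \<phi> p) - T (p, \<phi> p)) \<le> (\<bar>K\<bar> + 1) * norm (x - p)"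
        using norm_triangle_sub[of "T (x, \<phi> p) - T (p, \<phi> p)" "T' (x - p, 0)"]
        by (simp add: distrib_right)
      have "norm (\<phi> x - \<phi> p) \<le> norm (T (x, \<phi> x) - T (x, \<phi> p)) + norm (T (x, \<phi> p) - T (p, \<phi> p))"
        using fp[OF xU] fp[OF U(2)]
          norm_triangle_ineq[of "T (x, \<phi> x) - T (x, \<phi> p)" "T (x, \<phi> p) - T (p, \<phi> p)"] by simp
      also have "\<dots> \<le> q * norm (\<phi> x - \<phi> p) + (\<bar>K\<bar> + 1) * norm (x - p)"
        using contr[OF xU] 1 by linarith
      finally have "(1 - q) * norm (\<phi> x - \<phi> p) \<le> (\<bar>K\<bar> + 1) * norm (x - p)" by (simp add: algebra_simps)
      then show "x \<in> U \<and> norm (\<phi> x - \<phi> p) \<le> C * norm (x - p)"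
        using xU q by (simp add: C_def field_simps)
    qed (use d u in auto)
  qed
  have "(\<phi> has_derivative D) (at p)"
    unfolding has_derivative_at_alt
  proof (intro conjI allI impI Dlin)
    fix e :: real assume e: "e > 0"
    \<comment> \<open>The factor \<open>1 + C\<close> passes from increments of the pair to
      increments of \<open>x\<close>; \<open>1 - q\<close> pays for the term
      \<open>T' (0, ?r)\<close>, which is absorbed into the left-hand side at the end.\<close>
    define e' where "e' = e * (1 - q) / (1 + C)"
    have e': "e' > 0" using e q C by (simp add: e'_def)
    obtain d where d: "d > 0" "\<And>y. norm (y - (p, \<phi> p)) < d \<Longrightarrow>
      norm (T y - T (p, \<phi> p) - T' (y - (p, \<phi> p))) \<le> e' * norm (y - (p, \<phi> p))"
      using der'[OF e'] by auto
    show "\<exists>d>0. \<forall>y. norm (y - p) < d \<longrightarrow> norm (\<phi> y - \<phi> p - D (y - p)) \<le> e * norm (y - p)"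
    proof (intro exI[of _ "min d1 (d / (1 + C))"] conjI allI impI)
      show "0 < min d1 (d / (1 + C))" using d1 d C by simp
      fix x assume x: "norm (x - p) < min d1 (d / (1 + C))"
      have xU: "x \<in> U" and L: "norm (\<phi> x - \<phi> p) \<le> C * norm (x - p)" using lip x by auto
      have nn: "norm ((x, \<phi> x) - (p, \<phi> p)) \<le> (1 + C) * norm (x - p)"
        using nP[of "x - p" "\<phi> x - \<phi> p"] L by (simp add: algebra_simps)
      also have "\<dots> < d" using x C by (simp add: field_simps)
      finally have "norm (T (x, \<phi> x) - T (p, \<phi> p) - T' ((x, \<phi> x) - (p, \<phi> p))) \<le> e' * norm ((x, \<phi> x) - (p, \<phi> p))"
        by (rule d)
      also have "\<dots> \<le> e' * ((1 + C) * norm (x - p))" using nn e' by (intro mult_left_mono) auto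
      also have "\<dots> = e * (1 - q) * norm (x - p)" using C by (simp add: e'_def)
      finally have A: "norm (\<phi> x - \<phi> p - T' (x - p, \<phi> x - \<phi> p)) \<le> e * (1 - q) * norm (x - p)"
        using fp xU U by simp
      let ?r = "\<phi> x - \<phi> p - D (x - p)"
      have "?r = (\<phi> x - \<phi> p - T' (x - p, \<phi> x - \<phi> p)) + T' (0, ?r)"
        using T'.diff[of "(x - p, \<phi> x - \<phi> p)" "(x - p, D (x - p))"] D[of "x - p"] by simp
      then have "norm ?r \<le> norm (\<phi> x - \<phi> p - T' (x - p, \<phi> x - \<phi> p)) + norm (T' (0, ?r))"
        by (metis norm_triangle_ineq)
      also have "\<dots> \<le> e * (1 - q) * norm (x - p) + q * norm ?r" using A lin by (intro add_mono) auto
      finally have "(1 - q) * norm ?r \<le> (1 - q) * (e * norm (x - p))" by (simp add: algebra_simps)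
      then show "norm ?r \<le> e * norm (x - p)" using q by simp
    qed
  qed
  then show ?thesis using D that by metis
qed

section \<open>Markov operators on bounded continuous functions\<close>

lemma apply_Bcontfun:
  fixes f :: "'z::topological_space \<Rightarrow> real"
  assumes "continuous_on UNIV f" "\<And>z. \<bar>f z\<bar> \<le> b"
  shows "apply_bcontfun (Bcontfun f) = f"
  using assms by (intro Bcontfun_inverse bcontfun_normI) auto

lemma abs_apply_bcontfun_le: "\<bar>apply_bcontfun f z\<bar> \<le> norm f" for f :: "'z::topological_space \<Rightarrow>\<^sub>C real"
  using norm_bounded[of f z] by simp

lemma norm_bcontfun_le: "(\<And>z. \<bar>apply_bcontfun f z\<bar> \<le> b) \<Longrightarrow> norm f \<le> b"
  for f :: "'z::topological_space \<Rightarrow>\<^sub>C real"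
  by (rule norm_bound) simp

lemma continuous_on_apply_bcontfun_comp [continuous_intros]:
  fixes f :: "'z::topological_space \<Rightarrow>\<^sub>C 'b::metric_space"
  shows "continuous_on S g \<Longrightarrow> continuous_on S (\<lambda>x. apply_bcontfun f (g x))"
  using continuous_on_compose2[OF continuous_on_apply_bcontfun[of UNIV f]] by auto

definition bmul :: "('z::topological_space \<Rightarrow>\<^sub>C real) \<Rightarrow> ('z \<Rightarrow>\<^sub>C real) \<Rightarrow> ('z \<Rightarrow>\<^sub>C real)" (infixl \<open>\<odot>\<close> 70)
  where "f \<odot> g = Bcontfun (\<lambda>z. f z * g z)"

definition bexp :: "('z::topological_space \<Rightarrow>\<^sub>C real) \<Rightarrow> ('z \<Rightarrow>\<^sub>C real)"
  where "bexp f = Bcontfun (\<lambda>z. exp (f z))"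

lemma apply_bmul [simp]: "apply_bcontfun (f \<odot> g) z = f z * g z"
proof -
  have "apply_bcontfun (f \<odot> g) = (\<lambda>z. f z * g z)"
    unfolding bmul_def
    by (rule apply_Bcontfun[of _ "norm f * norm g"])
       (auto intro!: continuous_intros mult_mono abs_apply_bcontfun_le simp: abs_mult)
  then show ?thesis by simp
qed

lemma apply_bexp [simp]: "apply_bcontfun (bexp f) z = exp (f z)"
proof -
  have "apply_bcontfun (bexp f) = (\<lambda>z. exp (f z))"
    unfolding bexp_def
    by (rule apply_Bcontfun[of _ "exp (norm f)"])
       (auto intro!: continuous_intros order_trans[OF abs_ge_self] abs_apply_bcontfun_le)
  then show ?thesis by simp
qed

lemma bounded_bilinear_bmul: "bounded_bilinear (\<odot>)"
proof
  show "\<exists>K. \<forall>a b. norm (a \<odot> b) \<le> norm a * norm b * K"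
    by (intro exI[of _ 1] allI norm_bcontfun_le)
       (auto simp: abs_mult intro!: mult_mono abs_apply_bcontfun_le)
qed (auto intro!: bcontfun_eqI simp: algebra_simps)

interpretation bmul: bounded_bilinear "(\<odot>)" by (rule bounded_bilinear_bmul)

lemmas continuous_on_bmul [continuous_intros] = bmul.continuous_on

lemma abs_exp_minus_linear_le:
  assumes "\<bar>t::real\<bar> \<le> 1" shows "\<bar>exp t - 1 - t\<bar> \<le> t\<^sup>2"
proof -
  have "exp t \<le> 1 + t + t\<^sup>2"
  proof (cases "t \<ge> 0")
    case False
    \<comment> \<open>For negative \<open>t\<close> the claim reads
      \<open>1 \<le> exp (- t) * (1 + t + t\<^sup>2)\<close>; the quadratic Taylor bound times the
      bracket is 1 plus nonnegative terms.\<close>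
    then have "exp (-t) \<ge> 1 - t + t\<^sup>2 / 2" using exp_lower_Taylor_quadratic[of "-t"] by simp
    moreover have "(1 - t + t\<^sup>2/2) * (1 + t + t\<^sup>2) = 1 + t\<^sup>2 / 2 - t^3/2 + t^4/2"
      by (simp add: field_simps power2_eq_square power3_eq_cube power4_eq_xxxx)
    moreover have "t^3 \<le> 0" using False by (simp add: power_le_zero_eq)
    moreover have "0 < 1 + t + t\<^sup>2" using assms False by (cases "t = -1") (auto intro: add_pos_nonneg)
    moreover have "0 \<le> t\<^sup>2" "0 \<le> t^4" by simp_all
    moreover from calculation have "(1 - t + t\<^sup>2/2) * (1 + t + t\<^sup>2) \<le> exp (-t) * (1 + t + t\<^sup>2)"
      by (intro mult_right_mono) linarith+
    ultimately have "1 \<le> exp (-t) * (1 + t + t\<^sup>2)" by linarith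
    then show ?thesis by (simp add: exp_minus field_simps)
  qed (use exp_bound[of t] assms in auto)
  moreover have "1 + t \<le> exp t" by (rule exp_ge_add_one_self)
  ultimately show ?thesis using zero_le_power2[of t] unfolding abs_le_iff by linarith
qed

lemma has_derivative_of_quadratic_bound:
  fixes F :: "'a::real_normed_vector \<Rightarrow> 'b::real_normed_vector"
  assumes "bounded_linear F'"
    and bound: "\<And>h. norm h \<le> 1 \<Longrightarrow> norm (F (x + h) - F x - F' h) \<le> c * (norm h)\<^sup>2"
  shows "(F has_derivative F') (at x)"
  unfolding has_derivative_at_alt
proof (intro conjI allI impI assms(1))
  fix e :: real assume e: "e > 0"
  define d where "d = min 1 (e / (\<bar>c\<bar> + 1))"
  show "\<exists>d>0. \<forall>y. norm (y - x) < d \<longrightarrow> norm (F y - F x - F' (y - x)) \<le> e * norm (y - x)"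
  proof (intro exI[of _ d] conjI allI impI)
    show "d > 0" using e by (simp add: d_def)
    fix y assume y: "norm (y - x) < d"
    have "norm (F y - F x - F' (y - x)) \<le> c * (norm (y - x))\<^sup>2"
      using bound[of "y - x"] y by (simp add: d_def)
    also have "\<dots> \<le> ((\<bar>c\<bar> + 1) * norm (y - x)) * norm (y - x)"
      unfolding power2_eq_square mult.assoc by (intro mult_right_mono) auto
    also have "\<dots> \<le> e * norm (y - x)"
    proof (rule mult_right_mono)
      have "norm (y - x) \<le> e / (\<bar>c\<bar> + 1)" using y by (simp add: d_def)
      then show "(\<bar>c\<bar> + 1) * norm (y - x) \<le> e" by (simp add: field_simps)
    qed simp
    finally show "norm (F y - F x - F' (y - x)) \<le> e * norm (y - x)" .
  qed
qed

lemma has_derivative_bexp: "(bexp has_derivative (\<lambda>h. bexp f \<odot> h)) (at f)"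
proof (rule has_derivative_of_quadratic_bound[where c = "norm (bexp f)"])
  show "bounded_linear ((\<odot>) (bexp f))" by (rule bmul.bounded_linear_right)
  fix h :: "'a \<Rightarrow>\<^sub>C real" assume h: "norm h \<le> 1"
  show "norm (bexp (f + h) - bexp f - bexp f \<odot> h) \<le> norm (bexp f) * (norm h)\<^sup>2"
  proof (rule norm_bcontfun_le)
    fix z
    have hz: "\<bar>h z\<bar> \<le> norm h" by (rule abs_apply_bcontfun_le)
    have "\<bar>apply_bcontfun (bexp (f + h) - bexp f - bexp f \<odot> h) z\<bar> = \<bar>exp (f z) * (exp (h z) - 1 - h z)\<bar>"
      by (simp add: exp_add algebra_simps)
    also have "\<dots> = exp (f z) * \<bar>exp (h z) - 1 - h z\<bar>" by (simp add: abs_mult)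
    also have "\<dots> \<le> norm (bexp f) * (norm h)\<^sup>2"
    proof (rule mult_mono)
      show "exp (f z) \<le> norm (bexp f)" using abs_apply_bcontfun_le[of "bexp f" z] by simp
      have "\<bar>exp (h z) - 1 - h z\<bar> \<le> (h z)\<^sup>2" using abs_exp_minus_linear_le hz h by force
      also have "\<dots> \<le> (norm h)\<^sup>2" using hz by (simp add: abs_le_square_iff[symmetric])
      finally show "\<bar>exp (h z) - 1 - h z\<bar> \<le> (norm h)\<^sup>2" .
    qed auto
    finally show "\<bar>apply_bcontfun (bexp (f + h) - bexp f - bexp f \<odot> h) z\<bar> \<le> norm (bexp f) * (norm h)\<^sup>2" .
  qed
qed

lemmas has_derivative_bexp_comp [derivative_intros] = has_derivative_compose[OF _ has_derivative_bexp]

lemma continuous_on_bexp [continuous_intros]: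
  "continuous_on S g \<Longrightarrow> continuous_on S (\<lambda>x. bexp (g x))"
  by (rule continuous_on_compose2[of UNIV bexp])
     (auto intro!: continuous_at_imp_continuous_on has_derivative_continuous[OF has_derivative_bexp])

text \<open>Averages over one marginal, the full mean and all exponential tilts of these are
  instances, so monotonicity, the norm bound and the calculus of \<open>lse\<close> are proved once,
  without integrals.\<close>

locale markov_op =
  fixes M :: "('z::topological_space \<Rightarrow>\<^sub>C real) \<Rightarrow> ('z \<Rightarrow>\<^sub>C real)"
  assumes add: "M (f + g) = M f + M g" and scale: "M (c *\<^sub>R f) = c *\<^sub>R M f"
    and nonneg: "(\<And>z. 0 \<le> f z) \<Longrightarrow> 0 \<le> M f z"
    and one: "M (const_bcontfun 1) = const_bcontfun 1"
begin

lemma linear: "linear M"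
  by (rule linearI) (rule add scale)+

lemma diff: "M (f - g) = M f - M g"
  using linear by (rule linear_diff)

lemma const: "M (const_bcontfun c) = const_bcontfun c"
proof -
  have "const_bcontfun c = c *\<^sub>R const_bcontfun (1::real)" by (rule bcontfun_eqI) simp
  then show ?thesis using scale[of c "const_bcontfun 1"] one by metis
qed

lemma mono: fixes f g :: "'z \<Rightarrow>\<^sub>C real" shows "(\<And>z. f z \<le> g z) \<Longrightarrow> M f z \<le> M g z"
  using nonneg[of "g - f" z] by (simp add: diff)

lemma upper: fixes f :: "'z \<Rightarrow>\<^sub>C real" shows "(\<And>z. f z \<le> c) \<Longrightarrow> M f z \<le> c"
  using mono[of f "const_bcontfun c" z] by (simp add: const)

lemma lower: fixes f :: "'z \<Rightarrow>\<^sub>C real" shows "(\<And>z. c \<le> f z) \<Longrightarrow> c \<le> M f z"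
  using mono[of "const_bcontfun c" f z] by (simp add: const)

lemma norm_le: "norm (M f) \<le> norm f"
proof (rule norm_bcontfun_le)
  fix z
  have "f z \<le> norm f" "- norm f \<le> f z" for z using abs_apply_bcontfun_le[of f z] by auto
  then show "\<bar>M f z\<bar> \<le> norm f" by (auto simp: abs_le_iff minus_le_iff[of _ "norm f"] intro!: upper lower)
qed

lemma bounded_linear: "bounded_linear M"
  by (rule bounded_linear_intro[where K = 1]) (auto simp: add scale norm_le)

lemmas has_derivative_M [derivative_intros] = bounded_linear.has_derivative[OF bounded_linear]
lemmas continuous_on_M [continuous_intros] = bounded_linear.continuous_on[OF bounded_linear]

lemma M_bexp_ge: "exp (- norm f) \<le> M (bexp f) z"
  by (rule lower) (use abs_apply_bcontfun_le[of f] in \<open>auto simp: abs_le_iff minus_le_iff\<close>)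

lemma M_bexp_le: "M (bexp f) z \<le> exp (norm f)"
  by (rule upper) (use abs_apply_bcontfun_le[of f] in \<open>auto simp: abs_le_iff\<close>)

lemma M_bexp_pos: "0 < M (bexp f) z"
  using M_bexp_ge[of f z] exp_gt_zero[of "- norm f"] by linarith

text \<open>The log-sum-exp, or soft maximum. Applied to payoff minus potential it is the soft
  c-transform, that is, half a Sinkhorn step.\<close>

definition lse :: "('z \<Rightarrow>\<^sub>C real) \<Rightarrow> ('z \<Rightarrow>\<^sub>C real)"
  where "lse f = Bcontfun (\<lambda>z. ln (M (bexp f) z))"

lemma apply_lse [simp]: "lse f z = ln (M (bexp f) z)"
proof -
  have "\<bar>ln (M (bexp f) z)\<bar> \<le> norm f" for z
  proof -
    have "- norm f \<le> ln (M (bexp f) z)"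
      using M_bexp_ge[of f z] M_bexp_pos[of f z] by (simp add: ln_ge_iff)
    moreover have "ln (M (bexp f) z) \<le> norm f"
      using ln_mono[OF M_bexp_le[of f z] M_bexp_pos[of f z]] by simp
    ultimately show ?thesis by linarith
  qed
  then have "apply_bcontfun (lse f) = (\<lambda>z. ln (M (bexp f) z))"
    unfolding lse_def
    by (intro apply_Bcontfun continuous_intros) (metis M_bexp_pos less_numeral_extra(3))
  then show ?thesis by simp
qed

lemma exp_lse: "exp (lse f z) = M (bexp f) z"
  by (simp add: M_bexp_pos)

lemma lse_upper: fixes f :: "'z \<Rightarrow>\<^sub>C real" shows "(\<And>z. f z \<le> c) \<Longrightarrow> lse f z \<le> c"
  using upper[of "bexp f" "exp c" z] exp_lse[of f z] by (simp del: apply_lse) (metis exp_le_cancel_iff)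

lemma lse_lower: fixes f :: "'z \<Rightarrow>\<^sub>C real" shows "(\<And>z. c \<le> f z) \<Longrightarrow> c \<le> lse f z"
  using lower[of "exp c" "bexp f" z] exp_lse[of f z] by (simp del: apply_lse) (metis exp_le_cancel_iff)

lemma lse_mono: fixes f g :: "'z \<Rightarrow>\<^sub>C real" shows "(\<And>z. f z \<le> g z + c) \<Longrightarrow> lse f z \<le> lse g z + c"
proof -
  assume *: "\<And>z. f z \<le> g z + c"
  have "M (bexp f) z \<le> M (exp c *\<^sub>R bexp g) z"
    by (rule mono) (use * in \<open>simp flip: exp_add add: add.commute\<close>)
  then have "exp (lse f z) \<le> exp (lse g z + c)"
    unfolding exp_lse exp_add by (simp add: scale mult.commute)
  then show ?thesis by (simp only: exp_le_cancel_iff)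
qed

text \<open>The derivative of \<open>lse\<close> at \<open>f\<close>: an average reweighted by a
  density proportional to \<open>exp f\<close>. The product with \<open>bexp (- lse f)\<close>
  replaces a quotient, so that continuity in \<open>f\<close> follows from that of
  \<open>lse\<close> and of the product.\<close>

definition tilt :: "('z \<Rightarrow>\<^sub>C real) \<Rightarrow> ('z \<Rightarrow>\<^sub>C real) \<Rightarrow> ('z \<Rightarrow>\<^sub>C real)"
  where "tilt f h = bexp (- lse f) \<odot> M (bexp f \<odot> h)"

lemma apply_tilt: "tilt f h z = M (bexp f \<odot> h) z / M (bexp f) z"
proof -
  have "tilt f h z = exp (- lse f z) * M (bexp f \<odot> h) z" by (simp add: tilt_def del: apply_lse)
  also have "\<dots> = M (bexp f \<odot> h) z / M (bexp f) z"
    unfolding exp_minus exp_lse by (simp add: divide_inverse mult.commute)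
  finally show ?thesis .
qed

lemma markov_tilt: "markov_op (tilt f)"
proof
  show "tilt f (g + h) = tilt f g + tilt f h" for g h
    by (simp add: tilt_def bmul.add_right add)
  show "tilt f (c *\<^sub>R g) = c *\<^sub>R tilt f g" for c g
    by (simp add: tilt_def bmul.scaleR_right scale)
  show "0 \<le> tilt f h z" if "\<And>z. 0 \<le> h z" for h :: "'z \<Rightarrow>\<^sub>C real" and z
    unfolding apply_tilt using M_bexp_pos[of f z] nonneg[of "bexp f \<odot> h" z] that by simp
  show "tilt f (const_bcontfun 1) = const_bcontfun 1"
  proof (rule bcontfun_eqI)
    have "bexp f \<odot> const_bcontfun 1 = bexp f" by (rule bcontfun_eqI) simp
    then show "tilt f (const_bcontfun 1) z = const_bcontfun 1 z" for z
      using M_bexp_pos[of f z] by (simp add: apply_tilt)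
  qed
qed

text \<open>The lower bound is Jensen's inequality, obtained from the tangent of \<open>exp\<close>
  at \<open>M h z\<close>; the upper one combines \<open>exp t \<le> 1 + t + t\<^sup>2\<close> under
  the average with \<open>1 + s \<le> exp s\<close> outside it.\<close>

lemma lse_taylor:
  assumes "norm h \<le> 1"
  shows "M h z \<le> lse h z" "lse h z \<le> M h z + (norm h)\<^sup>2"
proof -
  let ?m = "M h z"
  have hz: "\<bar>h z\<bar> \<le> norm h" for z by (rule abs_apply_bcontfun_le)
  have "M (exp ?m *\<^sub>R (const_bcontfun (1 - ?m) + h)) z \<le> M (bexp h) z"
  proof (rule mono)
    fix w
    have "exp ?m * (1 + (h w - ?m)) \<le> exp ?m * exp (h w - ?m)"
      by (intro mult_left_mono exp_ge_add_one_self) auto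
    then show "apply_bcontfun (exp ?m *\<^sub>R (const_bcontfun (1 - ?m) + h)) w \<le> bexp h w"
      by (simp add: exp_diff algebra_simps)
  qed
  then have "exp ?m \<le> exp (lse h z)"
    unfolding exp_lse by (simp add: scale add const)
  then show "M h z \<le> lse h z" by (simp only: exp_le_cancel_iff)
  have "M (bexp h) z \<le> M (const_bcontfun (1 + (norm h)\<^sup>2) + h) z"
  proof (rule mono)
    fix w
    have "\<bar>exp (h w) - 1 - h w\<bar> \<le> (h w)\<^sup>2" using abs_exp_minus_linear_le hz[of w] assms by force
    moreover have "(h w)\<^sup>2 \<le> (norm h)\<^sup>2" using hz[of w] by (simp add: abs_le_square_iff[symmetric])
    ultimately show "bexp h w \<le> apply_bcontfun (const_bcontfun (1 + (norm h)\<^sup>2) + h) w" by simp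
  qed
  also have "\<dots> = 1 + (?m + (norm h)\<^sup>2)" by (simp add: add const)
  also have "\<dots> \<le> exp (?m + (norm h)\<^sup>2)" by (rule exp_ge_add_one_self)
  finally have "exp (lse h z) \<le> exp (?m + (norm h)\<^sup>2)" unfolding exp_lse .
  then show "lse h z \<le> M h z + (norm h)\<^sup>2" by (simp only: exp_le_cancel_iff)
qed

text \<open>Increments of \<open>lse\<close> at \<open>f\<close> are values of the log-sum-exp of
  the tilted operator, so the expansion of the latter at 0 is the expansion at \<open>f\<close>,
  with an error constant independent of \<open>f\<close>.\<close>

lemma has_derivative_lse: "(lse has_derivative tilt f) (at f)"
proof (rule has_derivative_of_quadratic_bound[where c = 1])
  interpret N: markov_op "tilt f" by (rule markov_tilt)
  show "bounded_linear (tilt f)" by (rule N.bounded_linear)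
  fix h :: "'z \<Rightarrow>\<^sub>C real" assume h: "norm h \<le> 1"
  show "norm (lse (f + h) - lse f - tilt f h) \<le> 1 * (norm h)\<^sup>2"
  proof (rule norm_bcontfun_le)
    fix z
    have eq: "bexp f \<odot> bexp h = bexp (f + h)" by (rule bcontfun_eqI) (simp add: exp_add)
    have "N.lse h z = lse (f + h) z - lse f z"
      using M_bexp_pos[of f z] M_bexp_pos[of "f + h" z] by (simp add: apply_tilt eq ln_div)
    then show "\<bar>(lse (f + h) - lse f - tilt f h) z\<bar> \<le> 1 * (norm h)\<^sup>2"
      using N.lse_taylor[OF h, of z] by (simp del: apply_lse N.apply_lse)
  qed
qed

lemmas has_derivative_lse_comp [derivative_intros] = has_derivative_compose[OF _ has_derivative_lse]

lemma continuous_on_lse [continuous_intros]: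
  "continuous_on S g \<Longrightarrow> continuous_on S (\<lambda>x. lse (g x))"
  by (rule continuous_on_compose2[of UNIV lse])
     (auto intro!: continuous_at_imp_continuous_on has_derivative_continuous[OF has_derivative_lse])

lemma continuous_on_tilt [continuous_intros]:
  "continuous_on S g \<Longrightarrow> continuous_on S h \<Longrightarrow> continuous_on S (\<lambda>x. tilt (g x) (h x))"
  unfolding tilt_def by (intro continuous_intros)

text \<open>Relative to \<open>M\<close> the tilted average has density
  \<open>exp f / M (bexp f)\<close>, which is at least \<open>exp (- c)\<close> when
  \<open>f\<close> oscillates by at most \<open>c\<close>. This is the minorization that Doeblin's
  argument needs.\<close>

lemma tilt_ge:
  fixes f h :: "'z \<Rightarrow>\<^sub>C real"
  assumes osc: "\<And>z z'. f z \<le> f z' + c" and h: "\<And>z. 0 \<le> h z"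
  shows "exp (- c) * M h z \<le> tilt f h z"
proof -
  have "M (bexp f) z * M (exp (- c) *\<^sub>R h) z = M (M (bexp f) z *\<^sub>R (exp (- c) *\<^sub>R h)) z"
    by (simp add: scale)
  also have "\<dots> \<le> M (bexp f \<odot> h) z"
  proof (rule mono)
    fix w
    have "M (bexp f) z \<le> exp (f w + c)" by (rule upper) (use osc in simp)
    then have "M (bexp f) z * exp (- c) \<le> exp (f w)" by (simp add: exp_add exp_minus field_simps)
    then show "apply_bcontfun (M (bexp f) z *\<^sub>R (exp (- c) *\<^sub>R h)) w \<le> (bexp f \<odot> h) w"
      using mult_right_mono[OF _ h[of w]] by (simp flip: mult.assoc)
  qed
  finally show ?thesis
    using M_bexp_pos[of f z] by (simp add: apply_tilt scale field_simps)
qed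

end

section \<open>The Sinkhorn fixed point and the Schroedinger potentials\<close>

instance bcontfun :: (metric_space, banach) banach ..

definition osc_le :: "real \<Rightarrow> ('z::topological_space \<Rightarrow>\<^sub>C real) \<Rightarrow> bool"
  where "osc_le c f \<longleftrightarrow> (\<forall>z z'. f z \<le> f z' + c)"

lemma osc_le_norm: "norm f \<le> r \<Longrightarrow> osc_le (2 * r) f"
  unfolding osc_le_def
proof safe
  fix z z' assume "norm f \<le> r"
  then show "f z \<le> f z' + 2 * r"
    using abs_apply_bcontfun_le[of f z] abs_apply_bcontfun_le[of f z'] by linarith
qed

lemma osc_le_diff: "osc_le c f \<Longrightarrow> osc_le d g \<Longrightarrow> osc_le (c + d) (f - g)"
  unfolding osc_le_def
proof safe
  fix z z' assume "\<forall>z z'. f z \<le> f z' + c" "\<forall>z z'. g z \<le> g z' + d"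
  then have "f z \<le> f z' + c" "g z' \<le> g z + d" by blast+
  then show "(f - g) z \<le> (f - g) z' + (c + d)" by simp
qed

lemma (in markov_op) osc_le_lse: "osc_le c f \<Longrightarrow> osc_le c (lse f)"
  unfolding osc_le_def
proof safe
  fix z z' assume *: "\<forall>z z'. f z \<le> f z' + c"
  have "lse f z - c \<le> f w" for w
    using lse_upper[of f "f w + c" z] * by force
  then have "lse f z - c \<le> lse f z'" by (rule lse_lower)
  then show "lse f z \<le> lse f z' + c" by linarith
qed

text \<open>Functions of one variable are kept as functions on the product, so that potentials,
  costs and densities live in one Banach space and the operators map it into itself.\<close>

definition fst_only :: "(('a::topological_space \<times> 'b::topological_space) \<Rightarrow>\<^sub>C real) \<Rightarrow> bool"
  where "fst_only u \<longleftrightarrow> (\<forall>x y y'. u (x, y) = u (x, y'))"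

definition snd_only :: "(('a::topological_space \<times> 'b::topological_space) \<Rightarrow>\<^sub>C real) \<Rightarrow> bool"
  where "snd_only u \<longleftrightarrow> (\<forall>x x' y. u (x, y) = u (x', y))"

lemma fst_only_bexp: "fst_only u \<Longrightarrow> fst_only (bexp (- u))"
  and snd_only_bexp: "snd_only u \<Longrightarrow> snd_only (bexp (- u))"
  unfolding fst_only_def snd_only_def by (metis apply_bexp uminus_bcontfun.rep_eq)+

text \<open>\<open>M0\<close> averages out the second variable, \<open>M1\<close> the first. The
  pull-out rules are those of conditional expectations and \<open>commute\<close> is Fubini's
  theorem; this is all that the Schroedinger system and its derivatives require of the
  measures.\<close>

locale two_markov = M0: markov_op M0 + M1: markov_op M1
  for M0 M1 :: "(('a::metric_space \<times> 'b::metric_space) \<Rightarrow>\<^sub>C real) \<Rightarrow> (('a \<times> 'b) \<Rightarrow>\<^sub>C real)" +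
  assumes fst_only_M0: "fst_only (M0 h)"
    and snd_only_M1: "snd_only (M1 h)"
    and M0_pull: "fst_only u \<Longrightarrow> M0 (u \<odot> h) = u \<odot> M0 h"
    and M1_pull: "snd_only u \<Longrightarrow> M1 (u \<odot> h) = u \<odot> M1 h"
    and commute: "M0 (M1 h) = M1 (M0 h)"
begin

abbreviation "E h \<equiv> M0 (M1 h)"

text \<open>As a value of \<open>M0\<close> the function ignores the second variable; after
  commuting, as a value of \<open>M1\<close>, it ignores the first.\<close>

lemma E_const: "E h z = E h z'"
proof -
  obtain x y x' y' where z: "z = (x, y)" "z' = (x', y')" by (metis surj_pair)
  have "E h (x, y) = E h (x, y')" using fst_only_M0[of "M1 h"] by (simp add: fst_only_def)
  also have "\<dots> = E h (x', y')"
    unfolding commute using snd_only_M1[of "M0 h"] by (simp add: snd_only_def)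
  finally show ?thesis by (simp add: z)
qed

lemma markov_E: "markov_op (\<lambda>h. E h)"
  by standard (auto simp: M0.add M1.add M0.scale M1.scale M0.one M1.one intro!: M0.nonneg M1.nonneg)

sublocale E: markov_op "\<lambda>h. E h" by (rule markov_E)

lemma bmul_const_1: "f \<odot> const_bcontfun 1 = f" by (rule bcontfun_eqI) simp

lemma M0_id: "fst_only u \<Longrightarrow> M0 u = u"
  using M0_pull[of u "const_bcontfun 1"] by (simp add: M0.one bmul_const_1)

lemma M1_id: "snd_only u \<Longrightarrow> M1 u = u"
  using M1_pull[of u "const_bcontfun 1"] by (simp add: M1.one bmul_const_1)

lemma fst_only_lse: "fst_only (M0.lse h)"
  using fst_only_M0[of "bexp h"] by (simp add: fst_only_def) metis

lemma snd_only_lse: "snd_only (M1.lse h)"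
  using snd_only_M1[of "bexp h"] by (simp add: snd_only_def) metis

lemma lse0_snd_only:
  assumes "snd_only u" shows "M0.lse (- u) z = M0.lse (- u) z'"
proof -
  have "M1 (bexp (- u)) = bexp (- u)" by (rule M1_id[OF snd_only_bexp[OF assms]])
  then have "M0 (bexp (- u)) z = M0 (bexp (- u)) z'" using E_const[of "bexp (- u)" z z'] by simp
  then show ?thesis by simp
qed

text \<open>Half a Sinkhorn step forgets everything about the potential except an additive constant, up to
  the size of the cost.\<close>

lemma osc_half_step:
  assumes "norm f \<le> r" shows "osc_le (2 * r) (M0.lse (f - M1.lse g))"
  unfolding osc_le_def
proof safe
  fix x y x' y'
  let ?u = "- M1.lse g"
  have f: "- r \<le> f z" "f z \<le> r" for z using abs_apply_bcontfun_le[of f z] assms by auto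
  have "M0.lse (f - M1.lse g) (x, y) \<le> M0.lse ?u (x, y) + r"
    by (rule M0.lse_mono) (use f in \<open>simp del: M1.apply_lse add: algebra_simps\<close>)
  also have "M0.lse ?u (x, y) = M0.lse ?u (x', y')"
    by (rule lse0_snd_only[OF snd_only_lse])
  also have "\<dots> \<le> M0.lse (f - M1.lse g) (x', y') + r"
    by (rule M0.lse_mono) (use f in \<open>simp del: M1.apply_lse add: algebra_simps\<close>, smt (verit) f)
  finally show "M0.lse (f - M1.lse g) (x, y) \<le> M0.lse (f - M1.lse g) (x', y') + 2 * r" by simp
qed

definition sink :: "real \<Rightarrow> (('a \<times> 'b) \<Rightarrow>\<^sub>C real) \<times> (('a \<times> 'b) \<Rightarrow>\<^sub>C real) \<Rightarrow> (('a \<times> 'b) \<Rightarrow>\<^sub>C real)"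
  where "sink \<delta> = (\<lambda>(f, \<phi>). M0.lse (f - M1.lse (f - \<phi>)) - \<delta> *\<^sub>R E \<phi>)"

definition dsink where
  "dsink \<delta> f \<phi> = (\<lambda>(F, h). M0.tilt (f - M1.lse (f - \<phi>)) (F - M1.tilt (f - \<phi>) (F - h)) - \<delta> *\<^sub>R E h)"

lemma has_derivative_sink: "(sink \<delta> has_derivative dsink \<delta> f \<phi>) (at (f, \<phi>))"
proof -
  have "((\<lambda>p. M0.lse (fst p - M1.lse (fst p - snd p)) - \<delta> *\<^sub>R E (snd p)) has_derivative dsink \<delta> f \<phi>) (at (f, \<phi>))"
    by (rule derivative_eq_intros refl)+ (simp add: fun_eq_iff dsink_def split_beta)
  then show ?thesis by (simp add: sink_def case_prod_unfold)
qed

text \<open>Subtracting \<^term>\<open>\<delta> *\<^sub>R E h\<close> from the Markov operator leaves a positive operator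
  of mass \<open>1 - \<delta>\<close>: this is Doeblin's argument, and it turns the contraction of oscillations
  into a contraction for the supremum norm.\<close>

lemma norm_dsink_le:
  assumes f: "norm f \<le> r" and \<phi>: "osc_le (2 * r) \<phi>"
  shows "norm (dsink (exp (- 10 * r)) f \<phi> (0, h)) \<le> (1 - exp (- 10 * r)) * norm h"
proof -
  define g where "g = f - \<phi>"
  define k where "k = f - M1.lse g"
  interpret N0: markov_op "M0.tilt k" by (rule M0.markov_tilt)
  interpret N1: markov_op "M1.tilt g" by (rule M1.markov_tilt)
  define Q where "Q h = M0.tilt k (M1.tilt g h) - exp (- 10 * r) *\<^sub>R E h" for h
  \<comment> \<open>Oscillations add: \<open>4 * r\<close> is \<open>2 * r\<close> from
    \<open>f\<close> and \<open>2 * r\<close> from \<open>\<phi>\<close>, and \<open>6 * r\<close>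
    below is \<open>2 * r\<close> from \<open>f\<close> and \<open>4 * r\<close> from the
    log-sum-exp of \<open>g\<close>. The two minorizations multiply to
    \<open>exp (- 10 * r)\<close>.\<close>
  have og: "osc_le (4 * r) g" unfolding g_def using osc_le_diff[OF osc_le_norm[OF f] \<phi>] by simp
  have ok: "osc_le (6 * r) k" unfolding k_def
    using osc_le_diff[OF osc_le_norm[OF f] M1.osc_le_lse[OF og]] by simp
  have Q_nonneg: "0 \<le> Q h z" if h: "\<And>z. 0 \<le> h z" for h :: "('a \<times> 'b) \<Rightarrow>\<^sub>C real" and z
  proof -
    have 1: "exp (- (4 * r)) * M1 h z \<le> M1.tilt g h z" for z
      by (rule M1.tilt_ge) (use og h in \<open>auto simp: osc_le_def\<close>)
    have "exp (- 10 * r) * E h z = exp (- (6 * r)) * M0 (exp (- (4 * r)) *\<^sub>R M1 h) z"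
      by (simp add: M0.scale flip: mult.assoc exp_add)
    also have "\<dots> \<le> M0.tilt k (exp (- (4 * r)) *\<^sub>R M1 h) z"
      by (rule M0.tilt_ge) (use ok h in \<open>auto simp: osc_le_def intro!: mult_nonneg_nonneg M1.nonneg[of h]\<close>)
    also have "\<dots> \<le> M0.tilt k (M1.tilt g h) z"
      by (rule N0.mono) (use 1 in simp)
    finally show ?thesis by (simp add: Q_def)
  qed
  have Q_diff: "Q (a - b) = Q a - Q b" for a b
    by (simp add: Q_def N0.diff N1.diff M0.diff M1.diff algebra_simps)
  have Q_const: "Q (const_bcontfun c) z = (1 - exp (- 10 * r)) * c" for c z
    by (simp add: Q_def N0.const N1.const M0.const M1.const algebra_simps)
  have "dsink (exp (- 10 * r)) f \<phi> (0, h) = Q h"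
    using linear_neg[OF N1.linear, of h] linear_neg[OF N0.linear, of "- M1.tilt g h"]
    by (simp add: dsink_def Q_def flip: g_def k_def)
  moreover have "norm (Q h) \<le> (1 - exp (- 10 * r)) * norm h"
  proof (rule norm_bcontfun_le)
    fix z
    have h: "- norm h \<le> h z" "h z \<le> norm h" for z using abs_apply_bcontfun_le[of h z] by auto
    \<comment> \<open>A positive operator is controlled by its value on constants: positivity is
      used for \<open>norm h - h\<close> and \<open>norm h + h\<close>.\<close>
    have "0 \<le> Q (const_bcontfun (norm h) - h) z" by (rule Q_nonneg) (use h in simp)
    moreover have "0 \<le> Q (h - const_bcontfun (- norm h)) z" by (rule Q_nonneg) (simp, smt (verit) h)
    ultimately show "\<bar>Q h z\<bar> \<le> (1 - exp (- 10 * r)) * norm h"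
      by (simp add: Q_diff Q_const abs_le_iff)
  qed
  ultimately show ?thesis by simp
qed

lemma convex_osc_le: "convex {\<phi> :: ('a \<times> 'b) \<Rightarrow>\<^sub>C real. osc_le c \<phi>}"
proof (rule convexI)
  fix \<phi> \<phi>' :: "('a \<times> 'b) \<Rightarrow>\<^sub>C real" and u v :: real
  assume *: "\<phi> \<in> {\<phi>. osc_le c \<phi>}" "\<phi>' \<in> {\<phi>. osc_le c \<phi>}" "0 \<le> u" "0 \<le> v" "u + v = 1"
  have "u * \<phi> z + v * \<phi>' z \<le> u * \<phi> z' + v * \<phi>' z' + c" for z z'
  proof -
    have "u * \<phi> z \<le> u * (\<phi> z' + c)" "v * \<phi>' z \<le> v * (\<phi>' z' + c)"
      using * unfolding osc_le_def by (blast intro: mult_left_mono)+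
    moreover have "u * (\<phi> z' + c) + v * (\<phi>' z' + c) = u * \<phi> z' + v * \<phi>' z' + (u + v) * c"
      by (simp add: algebra_simps)
    ultimately show ?thesis using *(5) by simp
  qed
  then show "u *\<^sub>R \<phi> + v *\<^sub>R \<phi>' \<in> {\<phi>. osc_le c \<phi>}" by (simp add: osc_le_def)
qed

lemma closed_osc_le: "closed {\<phi> :: ('a \<times> 'b) \<Rightarrow>\<^sub>C real. osc_le c \<phi>}"
proof -
  have ev: "continuous_on UNIV (\<lambda>\<phi> :: ('a \<times> 'b) \<Rightarrow>\<^sub>C real. \<phi> z)" for z
  proof -
    have "bounded_linear (\<lambda>\<phi> :: ('a \<times> 'b) \<Rightarrow>\<^sub>C real. \<phi> z)"
      by (rule bounded_linear_intro[where K = 1]) (auto simp: abs_apply_bcontfun_le)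
    then show ?thesis by (rule bounded_linear.continuous_on) (rule continuous_on_id)
  qed
  show ?thesis
    unfolding osc_le_def Collect_all_eq
    by (intro closed_INT ballI closed_Collect_le continuous_intros ev)
qed

text \<open>The mean value inequality, for which the functions of bounded oscillation form a convex
  set on which the derivative bound holds.\<close>

lemma sink_contraction:
  assumes f: "norm f \<le> r" and \<phi>: "osc_le (2 * r) \<phi>" and \<phi>': "osc_le (2 * r) \<phi>'"
  shows "norm (sink (exp (- 10 * r)) (f, \<phi>) - sink (exp (- 10 * r)) (f, \<phi>'))
    \<le> (1 - exp (- 10 * r)) * norm (\<phi> - \<phi>')"
proof (rule differentiable_bound[OF convex_osc_le[of "2 * r"], where f = "\<lambda>\<phi>. sink (exp (- 10 * r)) (f, \<phi>)"])
  fix \<phi> :: "('a \<times> 'b) \<Rightarrow>\<^sub>C real" assume \<phi>: "\<phi> \<in> {\<phi>. osc_le (2 * r) \<phi>}"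
  have "((\<lambda>\<phi>. (f, \<phi>)) has_derivative (\<lambda>h. (0, h))) (at \<phi>)"
    by (auto intro!: derivative_eq_intros)
  from has_derivative_compose[OF this has_derivative_sink]
  show "((\<lambda>\<phi>. sink (exp (- 10 * r)) (f, \<phi>)) has_derivative (\<lambda>h. dsink (exp (- 10 * r)) f \<phi> (0, h))) (at \<phi> within {\<phi>. osc_le (2 * r) \<phi>})"
    by (rule has_derivative_at_withinI)
  have "r \<ge> 0" using f norm_ge_zero[of f] by linarith
  then show "onorm (\<lambda>h. dsink (exp (- 10 * r)) f \<phi> (0, h)) \<le> 1 - exp (- 10 * r)"
    by (intro onorm_bound norm_dsink_le f) (use \<phi> in auto)
qed (use \<phi> \<phi>' in auto)

text \<open>The Schroedinger system with the additive constant fixed by mean zero. No \<delta>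
  occurs, so a solution is a fixed point of \<open>sink \<delta>\<close> for every \<delta>, which
  can therefore be chosen according to the size of \<open>f\<close>.\<close>

definition is_pot where
  "is_pot f \<phi> \<longleftrightarrow> M0.lse (f - M1.lse (f - \<phi>)) = \<phi> \<and> E \<phi> = 0"

lemma is_pot_osc: "is_pot f \<phi> \<Longrightarrow> norm f \<le> r \<Longrightarrow> osc_le (2 * r) \<phi>"
  unfolding is_pot_def using osc_half_step[of f r "f - \<phi>"] by simp

lemma is_pot_sink: "is_pot f \<phi> \<Longrightarrow> sink \<delta> (f, \<phi>) = \<phi>"
  by (simp add: is_pot_def sink_def)

lemma bexp_lse_mul: 
  "fst_only u \<Longrightarrow> M0 (bexp (k - u)) = bexp (M0.lse k - u)"
  "snd_only v \<Longrightarrow> M1 (bexp (k - v)) = bexp (M1.lse k - v)"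
proof -
  have e: "bexp (k - u) = bexp (- u) \<odot> bexp k" for u
    by (rule bcontfun_eqI) (simp add: exp_diff exp_minus divide_inverse mult.commute)
  assume *: "fst_only u"
  have "M0 (bexp (- u) \<odot> bexp k) = bexp (- u) \<odot> M0 (bexp k)"
    by (rule M0_pull[OF fst_only_bexp[OF *]])
  then show "M0 (bexp (k - u)) = bexp (M0.lse k - u)"
    by (intro bcontfun_eqI) (simp add: e exp_diff exp_minus divide_inverse mult.commute M0.M_bexp_pos)
next
  have e: "bexp (k - u) = bexp (- u) \<odot> bexp k" for u
    by (rule bcontfun_eqI) (simp add: exp_diff exp_minus divide_inverse mult.commute)
  assume *: "snd_only v"
  have "M1 (bexp (- v) \<odot> bexp k) = bexp (- v) \<odot> M1 (bexp k)"
    by (rule M1_pull[OF snd_only_bexp[OF *]])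
  then show "M1 (bexp (k - v)) = bexp (M1.lse k - v)"
    by (intro bcontfun_eqI) (simp add: e exp_diff exp_minus divide_inverse mult.commute M1.M_bexp_pos)
qed

text \<open>A fixed point of \<^const>\<open>sink\<close> solves the Schroedinger system only up to the constant
  \<open>\<delta> *\<^sub>R E \<phi>\<close>; comparing the total masses computed from the two marginals shows that it vanishes.\<close>

lemma sink_fixpoint_is_pot:
  assumes fp: "sink \<delta> (f, \<phi>) = \<phi>" and \<delta>: "\<delta> > 0" shows "is_pot f \<phi>"
proof -
  define \<psi> where "\<psi> = M1.lse (f - \<phi>)"
  have eq: "\<phi> = M0.lse (f - \<psi>) - \<delta> *\<^sub>R E \<phi>" using fp by (simp add: sink_def \<psi>_def)
  have \<phi>c: "fst_only \<phi>"
    unfolding fst_only_def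
  proof (intro allI)
    fix x y y'
    have "\<phi> (x, y) = M0.lse (f - \<psi>) (x, y) - \<delta> * E \<phi> (x, y)" for x y
      using arg_cong[OF eq, of "\<lambda>u. apply_bcontfun u (x, y)"] by simp
    moreover have "M0.lse (f - \<psi>) (x, y) = M0.lse (f - \<psi>) (x, y')"
      using fst_only_lse[of "f - \<psi>"] unfolding fst_only_def by blast
    ultimately show "\<phi> (x, y) = \<phi> (x, y')" using E_const[of \<phi> "(x, y)" "(x, y')"] by (simp only:)
  qed
  have \<psi>c: "snd_only \<psi>" unfolding \<psi>_def by (rule snd_only_lse)
  let ?p = "bexp (f - \<phi> - \<psi>)"
  have "M1 ?p = const_bcontfun 1"
    using bexp_lse_mul(2)[OF \<psi>c, of "f - \<phi>"] by (intro bcontfun_eqI) (simp flip: \<psi>_def)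
  then have Ep: "E ?p = const_bcontfun 1" by (simp add: M0.one)
  have "M0 ?p = bexp (M0.lse (f - \<psi>) - \<phi>)"
    using bexp_lse_mul(1)[OF \<phi>c, of "f - \<psi>"] by (simp add: algebra_simps)
  also have "M0.lse (f - \<psi>) - \<phi> = \<delta> *\<^sub>R E \<phi>" using eq by (simp only: algebra_simps diff_eq_eq)
  finally have M0p: "M0 ?p = bexp (\<delta> *\<^sub>R E \<phi>)" .
  have "E \<phi> z = 0" for z
  proof -
    have "bexp (\<delta> *\<^sub>R E \<phi>) = const_bcontfun (exp (\<delta> * E \<phi> z))"
      by (rule bcontfun_eqI) (use E_const[of \<phi> _ z] in simp)
    then have "M1 (M0 ?p) z = exp (\<delta> * E \<phi> z)" by (simp add: M0p M1.const)
    then show ?thesis using Ep \<delta> unfolding commute by simp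
  qed
  then have "E \<phi> = 0" by (intro bcontfun_eqI) simp
  then show ?thesis using eq unfolding is_pot_def \<psi>_def by simp
qed

text \<open>Banach's theorem in the closed set of functions of oscillation at most
  \<open>2 * r\<close>. The step preserves this set because a half step already forces the bound and
  \<open>E \<phi>\<close> is constant. Uniqueness extends to all potentials since
  \<open>is_pot_osc\<close> places them in the set.\<close>

lemma ex1_pot: "\<exists>!\<phi>. is_pot f \<phi>"
proof -
  define r where "r = norm f"
  define \<delta> where "\<delta> = exp (- 10 * r)"
  have \<delta>: "0 < \<delta>" "\<delta> \<le> 1" by (auto simp: \<delta>_def r_def)
  let ?S = "{\<phi> :: ('a \<times> 'b) \<Rightarrow>\<^sub>C real. osc_le (2 * r) \<phi>}"
  have "\<exists>!\<phi>. \<phi> \<in> ?S \<and> sink \<delta> (f, \<phi>) = \<phi>"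
  proof (rule Banach_fix[where c = "1 - \<delta>"])
    show "Topological_Spaces.complete ?S" by (simp add: complete_eq_closed closed_osc_le)
    have "0 \<in> ?S" by (simp add: osc_le_def r_def)
    then show "?S \<noteq> {}" by blast
    have "osc_le (2 * r) (M0.lse (f - M1.lse (f - \<phi>)) - \<delta> *\<^sub>R E \<phi>)" for \<phi>
    proof -
      have "\<delta> * E \<phi> z \<le> \<delta> * E \<phi> z' + 0" for z z'
        using E_const[of \<phi> z z'] by (simp only: add_0_right order_refl)
      then have "osc_le 0 (\<delta> *\<^sub>R E \<phi>)" by (simp add: osc_le_def)
      from osc_le_diff[OF osc_half_step[of f r "f - \<phi>"] this] show ?thesis by (simp add: r_def)
    qed
    then show "(\<lambda>\<phi>. sink \<delta> (f, \<phi>)) ` ?S \<subseteq> ?S" by (auto simp: sink_def)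
    show "dist (sink \<delta> (f, x)) (sink \<delta> (f, y)) \<le> (1 - \<delta>) * dist x y" if "x \<in> ?S" "y \<in> ?S" for x y
      unfolding dist_norm \<delta>_def using that by (intro sink_contraction) (auto simp: r_def)
  qed (use \<delta> in auto)
  then show ?thesis
  proof (elim ex1E, intro ex1I)
    fix \<phi> assume "\<phi> \<in> ?S \<and> sink \<delta> (f, \<phi>) = \<phi>"
    then show "is_pot f \<phi>" using sink_fixpoint_is_pot[OF _ \<delta>(1)] by blast
  next
    fix \<phi> \<phi>' assume uniq: "\<forall>y. y \<in> ?S \<and> sink \<delta> (f, y) = y \<longrightarrow> y = \<phi>" and pot: "is_pot f \<phi>'"
    have "\<phi>' \<in> ?S" using is_pot_osc[OF pot, of r] by (simp add: r_def)
    then show "\<phi>' = \<phi>" using uniq is_pot_sink[OF pot] by blast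
  qed
qed

definition pot where "pot f = (THE \<phi>. is_pot f \<phi>)"
definition pot1 where "pot1 f = M1.lse (f - pot f)"
definition gibbs where "gibbs f = bexp (f - pot f - pot1 f)"

lemma is_pot_pot: "is_pot f (pot f)"
  unfolding pot_def by (rule theI'[OF ex1_pot])

lemma pot_eq: "pot f = M0.lse (f - pot1 f)" and E_pot: "E (pot f) = 0"
  using is_pot_pot[of f] unfolding is_pot_def pot1_def by (metis, blast)

lemma fst_only_pot: "fst_only (pot f)"
  unfolding pot_eq[of f] by (rule fst_only_lse)

lemma snd_only_pot1: "snd_only (pot1 f)"
  unfolding pot1_def by (rule snd_only_lse)

text \<open>Dividing by \<open>exp (pot1 f)\<close> normalizes exactly the average that defines
  \<open>pot1\<close>; \<open>M0_gibbs\<close> is the same for \<open>pot\<close>. Together they say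
  that the density has the prescribed marginals.\<close>

lemma M1_gibbs: "M1 (gibbs f) = const_bcontfun 1"
  unfolding gibbs_def bexp_lse_mul(2)[OF snd_only_pot1]
  by (rule bcontfun_eqI) (simp add: pot1_def)

lemma M0_gibbs: "M0 (gibbs f) = const_bcontfun 1"
proof -
  have "gibbs f = bexp ((f - pot1 f) - pot f)" by (simp add: gibbs_def algebra_simps)
  then show ?thesis
    by (intro bcontfun_eqI) (simp add: bexp_lse_mul(1)[OF fst_only_pot] del: M0.apply_lse flip: pot_eq)
qed

text \<open>The potential is the logarithm of the normalizing factor, so the tilt is a conditional
  expectation under the Gibbs coupling. The linearized Sinkhorn step thus alternates two conditional
  expectations.\<close>

lemma tilt0_gibbs: "M0.tilt (f - pot1 f) h = M0 (gibbs f \<odot> h)"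
proof -
  have "gibbs f \<odot> h = bexp (- pot f) \<odot> (bexp (f - pot1 f) \<odot> h)"
    by (rule bcontfun_eqI) (simp add: gibbs_def exp_diff exp_minus exp_add field_simps)
  moreover have "M0 (bexp (- pot f) \<odot> (bexp (f - pot1 f) \<odot> h)) = bexp (- pot f) \<odot> M0 (bexp (f - pot1 f) \<odot> h)"
    by (rule M0_pull[OF fst_only_bexp[OF fst_only_pot]])
  ultimately show ?thesis by (simp add: M0.tilt_def flip: pot_eq)
qed

lemma tilt1_gibbs: "M1.tilt (f - pot f) h = M1 (gibbs f \<odot> h)"
proof -
  have "gibbs f \<odot> h = bexp (- pot1 f) \<odot> (bexp (f - pot f) \<odot> h)"
    by (rule bcontfun_eqI) (simp add: gibbs_def exp_diff exp_minus exp_add field_simps)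
  moreover have "M1 (bexp (- pot1 f) \<odot> (bexp (f - pot f) \<odot> h)) = bexp (- pot1 f) \<odot> M1 (bexp (f - pot f) \<odot> h)"
    by (rule M1_pull[OF snd_only_bexp[OF snd_only_pot1]])
  ultimately show ?thesis by (simp add: M1.tilt_def flip: pot1_def)
qed

end

section \<open>Derivatives of the potentials, the Gibbs density and the free energy\<close>

context two_markov
begin

lemma pot_differentiable:
  obtains D where "(pot has_derivative D) (at f)"
    "\<And>F. D F = M0 (gibbs f \<odot> (F - M1 (gibbs f \<odot> (F - D F))))"
proof -
  \<comment> \<open>The extra 1 makes a single \<delta> work for all costs in the unit ball around
    \<open>f\<close>.\<close>
  define r where "r = norm f + 1"
  define \<delta> where "\<delta> = exp (- 10 * r)"
  have "r > 0" by (simp add: r_def add_nonneg_pos)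
  then have \<delta>: "0 < \<delta>" "\<delta> \<le> 1" by (auto simp: \<delta>_def)
  have le_r: "norm x \<le> r" if "x \<in> ball f 1" for x
    using that norm_triangle_sub[of x f] by (simp add: dist_norm r_def norm_minus_commute)
  have osc: "osc_le (2 * r) (pot x)" if "x \<in> ball f 1" for x
    using is_pot_osc[OF is_pot_pot le_r[OF that]] .
  have contr: "norm (sink \<delta> (x, pot x) - sink \<delta> (x, pot f)) \<le> (1 - \<delta>) * norm (pot x - pot f)"
    if "x \<in> ball f 1" for x
    unfolding \<delta>_def using that by (intro sink_contraction le_r osc) auto
  have lin: "norm (dsink \<delta> f (pot f) (0, h)) \<le> (1 - \<delta>) * norm h" for h
    unfolding \<delta>_def by (intro norm_dsink_le le_r osc) auto
  obtain D where D: "(pot has_derivative D) (at f)" "\<And>F. D F = dsink \<delta> f (pot f) (F, D F)"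
  proof (rule fixpoint_has_derivative[of "ball f 1" f "sink \<delta>" pot "dsink \<delta> f (pot f)" "1 - \<delta>"])
    show "(sink \<delta> has_derivative dsink \<delta> f (pot f)) (at (f, pot f))" by (rule has_derivative_sink)
    show "sink \<delta> (x, pot x) = pot x" for x by (rule is_pot_sink[OF is_pot_pot])
  qed (use \<delta> contr lin in auto)
  \<comment> \<open>The mean of \<open>pot\<close> vanishes identically, hence so does its
    derivative, and the correction term drops out of the equation for \<open>D\<close>.\<close>
  have "((\<lambda>f. E (pot f)) has_derivative (\<lambda>F. E (D F))) (at f)"
    by (rule E.has_derivative_M[OF D(1)])
  then have "((\<lambda>f. 0) has_derivative (\<lambda>F. E (D F))) (at f)" by (simp add: E_pot)
  then have ED: "E (D F) = 0" for F
    using fun_cong[OF has_derivative_unique[OF _ has_derivative_const]] by blast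
  have "D F = M0 (gibbs f \<odot> (F - M1 (gibbs f \<odot> (F - D F))))" for F
    using D(2)[of F] ED[of F] unfolding dsink_def by (simp flip: pot1_def add: tilt0_gibbs tilt1_gibbs)
  with D(1) that show ?thesis by blast
qed

definition dpot where "dpot f = frechet_derivative pot (at f)"
definition dpot1 where "dpot1 f F = M1 (gibbs f \<odot> (F - dpot f F))"
definition resid where "resid f F = F - dpot f F - dpot1 f F"

lemma has_derivative_pot: "(pot has_derivative dpot f) (at f)"
  and dpot_eq: "dpot f F = M0 (gibbs f \<odot> (F - dpot1 f F))"
proof -
  obtain D where D: "(pot has_derivative D) (at f)"
    "\<And>F. D F = M0 (gibbs f \<odot> (F - M1 (gibbs f \<odot> (F - D F))))"
    using pot_differentiable by blast
  have "D = dpot f" unfolding dpot_def by (rule frechet_derivative_at[OF D(1)])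
  with D show "(pot has_derivative dpot f) (at f)" "dpot f F = M0 (gibbs f \<odot> (F - dpot1 f F))"
    unfolding dpot1_def by metis+
qed

lemma E_dpot: "E (dpot f F) = 0"
proof -
  have "((\<lambda>f. E (pot f)) has_derivative (\<lambda>F. E (dpot f F))) (at f)"
    by (rule E.has_derivative_M[OF has_derivative_pot])
  then have "((\<lambda>f. 0) has_derivative (\<lambda>F. E (dpot f F))) (at f)" by (simp only: E_pot)
  from has_derivative_unique[OF this has_derivative_const] show ?thesis by (rule fun_cong)
qed

lemma has_derivative_pot1: "(pot1 has_derivative dpot1 f) (at f)"
proof -
  have "((\<lambda>f. M1.lse (f - pot f)) has_derivative (\<lambda>F. M1.tilt (f - pot f) (F - dpot f F))) (at f)"
    by (intro derivative_intros has_derivative_pot)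
  then show ?thesis by (simp add: pot1_def[abs_def] dpot1_def[abs_def] tilt1_gibbs)
qed

lemma has_derivative_gibbs: "(gibbs has_derivative (\<lambda>F. gibbs f \<odot> resid f F)) (at f)"
proof -
  have "((\<lambda>f. bexp (f - pot f - pot1 f)) has_derivative
      (\<lambda>F. bexp (f - pot f - pot1 f) \<odot> (F - dpot f F - dpot1 f F))) (at f)"
    by (intro derivative_intros has_derivative_pot has_derivative_pot1)
  then show ?thesis by (simp add: gibbs_def[abs_def] resid_def[abs_def])
qed

lemma continuous_on_pot [continuous_intros]: "continuous_on S g \<Longrightarrow> continuous_on S (\<lambda>x. pot (g x))"
  by (rule continuous_on_compose2[of UNIV pot])
     (auto intro!: continuous_at_imp_continuous_on has_derivative_continuous[OF has_derivative_pot])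

lemma continuous_on_gibbs [continuous_intros]: "continuous_on S g \<Longrightarrow> continuous_on S (\<lambda>x. gibbs (g x))"
  by (rule continuous_on_compose2[of UNIV gibbs])
     (auto intro!: continuous_at_imp_continuous_on has_derivative_continuous[OF has_derivative_gibbs])

lemma fst_only_dpot: "fst_only (dpot f F)"
  unfolding dpot_eq[of f F] by (rule fst_only_M0)

lemma snd_only_dpot1: "snd_only (dpot1 f F)"
  unfolding dpot1_def by (rule snd_only_M1)

lemma bmul_commute: "f \<odot> g = g \<odot> f" and bmul_assoc: "f \<odot> g \<odot> h = f \<odot> (g \<odot> h)"
  by (rule bcontfun_eqI; simp)+

lemma M0_gibbs_mul: "fst_only u \<Longrightarrow> M0 (gibbs f \<odot> u) = u"
  by (subst bmul_commute) (simp add: M0_pull M0_gibbs bmul_const_1)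

lemma M1_gibbs_mul: "snd_only u \<Longrightarrow> M1 (gibbs f \<odot> u) = u"
  by (subst bmul_commute) (simp add: M1_pull M1_gibbs bmul_const_1)

text \<open>With \<open>M1_gibbs_resid\<close> these are the normal equations: under the Gibbs
  coupling both conditional means of the residual vanish, so it is orthogonal to all functions of a
  single variable.\<close>

lemma M0_gibbs_resid: "M0 (gibbs f \<odot> resid f F) = 0"
proof -
  have "gibbs f \<odot> resid f F = gibbs f \<odot> (F - dpot1 f F) - gibbs f \<odot> dpot f F"
    by (simp add: resid_def bmul.diff_right bmul.add_right algebra_simps)
  then show ?thesis by (simp add: M0.diff M0_gibbs_mul[OF fst_only_dpot] flip: dpot_eq)
qed

lemma M1_gibbs_resid: "M1 (gibbs f \<odot> resid f F) = 0"
proof -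
  have "gibbs f \<odot> resid f F = gibbs f \<odot> (F - dpot f F) - gibbs f \<odot> dpot1 f F"
    by (simp add: resid_def bmul.diff_right bmul.add_right algebra_simps)
  then show ?thesis by (simp add: M1.diff M1_gibbs_mul[OF snd_only_dpot1] flip: dpot1_def)
qed

lemma E_gibbs_fst_only: "fst_only u \<Longrightarrow> E (gibbs f \<odot> u) = E u"
  by (simp add: commute M0_gibbs_mul M0_id)

lemma E_gibbs_snd_only: "snd_only u \<Longrightarrow> E (gibbs f \<odot> u) = E u"
  by (simp add: M1_gibbs_mul M1_id)

text \<open>By \<open>E_const\<close> the point of evaluation is immaterial;
  \<open>undefined\<close> only turns a constant function into a number.\<close>

definition gibbs_mean :: "(('a \<times> 'b) \<Rightarrow>\<^sub>C real) \<Rightarrow> (('a \<times> 'b) \<Rightarrow>\<^sub>C real) \<Rightarrow> real"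
  where "gibbs_mean f F = E (gibbs f \<odot> F) undefined"

text \<open>The mean of both potentials together, as \<open>pot\<close> has mean zero.
  \<open>KL_ext_ge\<close> and \<open>gibbs_coupling\<close> identify it as the optimal value of the
  variational problem.\<close>

definition free_energy :: "(('a \<times> 'b) \<Rightarrow>\<^sub>C real) \<Rightarrow> real"
  where "free_energy f = E (pot1 f) undefined"

definition gibbs_cov where "gibbs_cov f F H = gibbs_mean f (resid f F \<odot> H)"

lemma bounded_linear_eval: "bounded_linear (\<lambda>u :: 'z::topological_space \<Rightarrow>\<^sub>C real. u z)"
  by (rule bounded_linear_intro[where K = 1]) (auto simp: abs_apply_bcontfun_le)

lemma bounded_linear_E_eval: "bounded_linear (\<lambda>u. E u z)"
  using bounded_linear_compose[OF bounded_linear_eval E.bounded_linear] by simp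

text \<open>An envelope principle: the variation of \<open>pot\<close> does not contribute, since
  \<open>dpot f F\<close> has mean zero under \<open>E\<close> and, the marginals being the same,
  also under the Gibbs coupling.\<close>

lemma has_derivative_free_energy: "(free_energy has_derivative gibbs_mean f) (at f)"
proof -
  have "E (dpot1 f F) = E (gibbs f \<odot> F)" for F
    using E_dpot E_gibbs_fst_only[OF fst_only_dpot, of f f F] snd_only_M1
    by (simp add: dpot1_def M1_id bmul.diff_right M1.diff M0.diff)
  moreover have "((\<lambda>f. E (pot1 f) undefined) has_derivative (\<lambda>F. E (dpot1 f F) undefined)) (at f)"
    by (rule bounded_linear.has_derivative[OF bounded_linear_E_eval has_derivative_pot1])
  ultimately show ?thesis by (simp add: free_energy_def[abs_def] gibbs_mean_def[abs_def])
qed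

lemma has_derivative_gibbs_mean: "((\<lambda>f. gibbs_mean f H) has_derivative (\<lambda>F. gibbs_cov f F H)) (at f)"
proof -
  have "((\<lambda>f. gibbs f \<odot> H) has_derivative (\<lambda>F. gibbs f \<odot> resid f F \<odot> H)) (at f)"
    by (rule bounded_linear.has_derivative[OF bmul.bounded_linear_left has_derivative_gibbs])
  then show ?thesis
    unfolding gibbs_mean_def gibbs_cov_def bmul_assoc[symmetric]
    by (rule bounded_linear.has_derivative[OF bounded_linear_E_eval])
qed

lemma linear_gibbs_mean: "linear (gibbs_mean f)"
  using has_derivative_linear[OF has_derivative_free_energy] .

lemma gibbs_mean_nonneg: "(\<And>z. 0 \<le> F z) \<Longrightarrow> 0 \<le> gibbs_mean f F" for F :: "('a \<times> 'b) \<Rightarrow>\<^sub>C real"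
  unfolding gibbs_mean_def by (rule E.nonneg) (simp add: gibbs_def)

text \<open>\<open>H\<close> and \<open>resid f H\<close> differ by a sum of one-variable functions,
  to which \<open>resid f F\<close> is orthogonal. Symmetry and positivity are read off from this
  form.\<close>

lemma gibbs_cov_eq: "gibbs_cov f F H = gibbs_mean f (resid f F \<odot> resid f H)"
proof -
  have sw: "gibbs f \<odot> (resid f F \<odot> u) = u \<odot> (gibbs f \<odot> resid f F)" for u
    by (rule bcontfun_eqI) simp
  have "E (gibbs f \<odot> (resid f F \<odot> u)) = 0" if "fst_only u" for u
    using M0_pull[OF that, of "gibbs f \<odot> resid f F"]
    by (simp add: commute sw M0_gibbs_resid bmul.zero_right linear_0[OF M1.linear])
  moreover have "E (gibbs f \<odot> (resid f F \<odot> u)) = 0" if "snd_only u" for u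
    using M1_pull[OF that, of "gibbs f \<odot> resid f F"]
    by (simp add: sw M1_gibbs_resid bmul.zero_right linear_0[OF M0.linear])
  ultimately have z: "E (gibbs f \<odot> (resid f F \<odot> dpot f H)) = 0" "E (gibbs f \<odot> (resid f F \<odot> dpot1 f H)) = 0"
    using fst_only_dpot snd_only_dpot1 by blast+
  have "gibbs f \<odot> (resid f F \<odot> resid f H) = gibbs f \<odot> (resid f F \<odot> H)
      - gibbs f \<odot> (resid f F \<odot> dpot f H) - gibbs f \<odot> (resid f F \<odot> dpot1 f H)"
    by (rule bcontfun_eqI) (simp add: resid_def algebra_simps)
  then show ?thesis
    unfolding gibbs_cov_def gibbs_mean_def by (simp only: E.diff z) simp
qed

lemma gibbs_cov_commute: "gibbs_cov f F H = gibbs_cov f H F"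
  unfolding gibbs_cov_eq by (subst bmul_commute) (rule refl)

lemma gibbs_cov_nonneg: "0 \<le> gibbs_cov f F F"
  unfolding gibbs_cov_eq by (rule gibbs_mean_nonneg) simp

text \<open>Pythagoras for \<open>F = w + u\<close> with residual \<open>w\<close>: as
  \<open>w \<odot> F\<close> and \<open>w \<odot> w\<close> have the same Gibbs mean, the mean of
  \<open>F \<odot> F\<close> exceeds the covariance by the mean of
  \<open>u \<odot> u\<close>.\<close>

lemma gibbs_cov_le: "gibbs_cov f F F \<le> gibbs_mean f (F \<odot> F)"
proof -
  let ?w = "resid f F" and ?u = "F - resid f F"
  have "F \<odot> F = ?w \<odot> F + ?w \<odot> F - ?w \<odot> ?w + ?u \<odot> ?u"
    by (rule bcontfun_eqI) (simp add: algebra_simps)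
  then have "gibbs_mean f (F \<odot> F) = gibbs_mean f (?w \<odot> F) + gibbs_mean f (?w \<odot> F) - gibbs_mean f (?w \<odot> ?w) + gibbs_mean f (?u \<odot> ?u)"
    by (simp add: linear_add[OF linear_gibbs_mean] linear_diff[OF linear_gibbs_mean])
  also have "gibbs_mean f (?w \<odot> F) = gibbs_cov f F F" by (simp add: gibbs_cov_def)
  also have "gibbs_mean f (?w \<odot> ?w) = gibbs_cov f F F" by (simp add: gibbs_cov_eq)
  finally show ?thesis using gibbs_mean_nonneg[of "?u \<odot> ?u" f] by simp
qed

text \<open>\<open>dpot f F\<close> solves an affine fixed point equation that contracts mean-zero
  increments, with a factor uniform near \<open>f0\<close>. Its distance from the old solution
  \<open>h\<close> is at most the defect \<open>A f - A f0\<close> of \<open>h\<close> in the new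
  equation, divided by \<delta>, and the defect tends to 0.\<close>

lemma continuous_dpot: "continuous (at f0) (\<lambda>f. dpot f F)"
proof -
  define r where "r = norm f0 + 1"
  define \<delta> where "\<delta> = exp (- 10 * r)"
  have \<delta>: "0 < \<delta>" by (auto simp: \<delta>_def)
  have le_r: "norm x \<le> r" if "x \<in> ball f0 1" for x
    using that norm_triangle_sub[of x f0] by (simp add: dist_norm r_def norm_minus_commute)
  define h where "h = dpot f0 F"
  define A where "A f = M0 (gibbs f \<odot> (F - M1 (gibbs f \<odot> (F - h))))" for f
  have h: "A f0 = h" unfolding A_def h_def using dpot_eq[of f0 F] by (simp add: dpot1_def)
  have Ac: "continuous (at f0) A"
    unfolding A_def by (rule continuous_on_interior[of UNIV]) (auto intro!: continuous_intros)
  have le: "norm (dpot f F - h) \<le> norm (A f - A f0) / \<delta>" if f: "f \<in> ball f0 1" for f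
  proof -
    let ?d = "dpot f F - h"
    have Ed: "E ?d = 0" using E_dpot by (simp add: h_def M0.diff M1.diff)
    have "?d = A f - A f0 + M0 (gibbs f \<odot> (0 - M1 (gibbs f \<odot> (0 - ?d))))"
      unfolding h using dpot_eq[of f F]
      by (simp add: A_def dpot1_def bmul.diff_right bmul.add_right M0.diff M1.diff M0.add M1.add bmul.minus_right linear_neg[OF M0.linear] linear_neg[OF M1.linear] algebra_simps)
    also have "M0 (gibbs f \<odot> (0 - M1 (gibbs f \<odot> (0 - ?d)))) = dsink \<delta> f (pot f) (0, ?d)"
      using Ed unfolding dsink_def by (simp flip: pot1_def add: tilt0_gibbs tilt1_gibbs)
    finally have "norm ?d \<le> norm (A f - A f0) + norm (dsink \<delta> f (pot f) (0, ?d))"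
      by (metis norm_triangle_ineq)
    also have "norm (dsink \<delta> f (pot f) (0, ?d)) \<le> (1 - \<delta>) * norm ?d"
      unfolding \<delta>_def using f by (intro norm_dsink_le le_r is_pot_osc[OF is_pot_pot])
    finally show ?thesis using \<delta> by (simp add: field_simps)
  qed
  have "((\<lambda>f. dpot f F - h) \<longlongrightarrow> 0) (at f0)"
  proof (rule Lim_null_comparison)
    show "\<forall>\<^sub>F f in at f0. norm (dpot f F - h) \<le> norm (A f - A f0) / \<delta>"
      by (rule eventually_at_in_open'[THEN eventually_mono, of "ball f0 1"]) (use le in auto)
    have "((\<lambda>f. norm (A f - A f0) / \<delta>) \<longlongrightarrow> norm (A f0 - A f0) / \<delta>) (at f0)"
      using Ac \<delta> unfolding continuous_at by (intro tendsto_intros) auto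
    then show "((\<lambda>f. norm (A f - A f0) / \<delta>) \<longlongrightarrow> 0) (at f0)" by simp
  qed
  then show ?thesis unfolding continuous_at h_def by (rule Lim_null[THEN iffD2])
qed

lemma continuous_on_gibbs_cov [continuous_intros]:
  assumes "continuous_on S g" shows "continuous_on S (\<lambda>x. gibbs_cov (g x) F H)"
proof -
  have d: "continuous_on S (\<lambda>x. dpot (g x) F)"
    by (rule continuous_on_compose2[of UNIV "\<lambda>f. dpot f F"])
       (auto intro: assms continuous_at_imp_continuous_on continuous_dpot)
  show ?thesis
    unfolding gibbs_cov_def gibbs_mean_def resid_def dpot1_def
    by (intro bounded_linear.continuous_on[OF bounded_linear_E_eval] continuous_intros d assms)
qed

text \<open>The upper bound is the nonnegativity of the relative entropy of the Gibbs coupling.\<close>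

lemma free_energy_le: "free_energy f \<le> norm f"
proof -
  have t: "exp t - 1 \<le> exp t * t" for t :: real
    using mult_left_mono[OF exp_ge_add_one_self[of "- t"], of "exp t"] by (simp add: exp_minus algebra_simps)
  let ?g = "f - pot f - pot1 f"
  have "E (gibbs f - const_bcontfun 1) undefined \<le> E (gibbs f \<odot> ?g) undefined"
    by (rule E.mono) (use t in \<open>simp add: gibbs_def\<close>)
  also have "E (gibbs f - const_bcontfun 1) undefined = 0"
    by (simp add: E.diff E.one M1_gibbs M1.one M0.one)
  also have "E (gibbs f \<odot> ?g) undefined = gibbs_mean f f - free_energy f"
    using E_pot[of f] by (simp add: bmul.diff_right E.diff E_gibbs_fst_only[OF fst_only_pot] E_gibbs_snd_only[OF snd_only_pot1]
        gibbs_mean_def free_energy_def)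
  also have "gibbs_mean f f \<le> gibbs_mean f (const_bcontfun (norm f))"
    unfolding gibbs_mean_def
    by (rule E.mono) (use abs_apply_bcontfun_le[of f] in \<open>auto simp: gibbs_def abs_le_iff\<close>)
  also have "gibbs_mean f (const_bcontfun (norm f)) = norm f"
    unfolding gibbs_mean_def by (subst E_gibbs_fst_only) (simp_all add: fst_only_def E.const)
  finally show ?thesis by simp
qed

end

section \<open>Averaging over the marginals and the Gibbs variational principle\<close>

lemma fst_onlyD: "fst_only u \<Longrightarrow> u (x, y) = u (x, y')"
  and snd_onlyD: "snd_only v \<Longrightarrow> v (x, y) = v (x', y)"
  unfolding fst_only_def snd_only_def by blast+

text \<open>Second countability makes the product sigma-algebra the Borel one, so that continuous
  functions on the product are measurable.\<close>

locale two_marginals = pair_prob_space \<mu> \<nu>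
  for \<mu> :: "'a::{metric_space, second_countable_topology} measure"
    and \<nu> :: "'b::{metric_space, second_countable_topology} measure" +
  assumes sets_\<mu>: "sets \<mu> = sets borel" and sets_\<nu>: "sets \<nu> = sets borel"
begin

lemma space_\<mu>: "space \<mu> = UNIV" and space_\<nu>: "space \<nu> = UNIV"
  using sets_eq_imp_space_eq[OF sets_\<mu>] sets_eq_imp_space_eq[OF sets_\<nu>] by simp_all

lemma sets_prod: "sets (\<mu> \<Otimes>\<^sub>M \<nu>) = sets borel"
  using sets_pair_measure_cong[OF sets_\<mu> sets_\<nu>] unfolding borel_prod .

lemma measurable_bcontfun: "apply_bcontfun h \<in> borel_measurable (\<mu> \<Otimes>\<^sub>M \<nu>)"
  for h :: "('a \<times> 'b) \<Rightarrow>\<^sub>C real"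
  unfolding measurable_cong_sets[OF sets_prod refl]
  by (intro borel_measurable_continuous_onI) auto

lemma measurable_section:
  fixes h :: "('a \<times> 'b) \<Rightarrow>\<^sub>C real"
  shows "(\<lambda>y. h (x, y)) \<in> borel_measurable \<nu>" "(\<lambda>x. h (x, y)) \<in> borel_measurable \<mu>"
  unfolding measurable_cong_sets[OF sets_\<nu> refl] measurable_cong_sets[OF sets_\<mu> refl]
  by (intro borel_measurable_continuous_onI continuous_intros)+

lemma integrable_section:
  fixes h :: "('a \<times> 'b) \<Rightarrow>\<^sub>C real"
  shows "integrable \<nu> (\<lambda>y. h (x, y))" "integrable \<mu> (\<lambda>x. h (x, y))"
  by (auto intro!: M1.integrable_const_bound[of _ "norm h"] M2.integrable_const_bound[of _ "norm h"]
      measurable_section abs_apply_bcontfun_le)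

definition avg0 :: "(('a \<times> 'b) \<Rightarrow>\<^sub>C real) \<Rightarrow> (('a \<times> 'b) \<Rightarrow>\<^sub>C real)"
  where "avg0 h = Bcontfun (\<lambda>(x, y). \<integral>y'. h (x, y') \<partial>\<nu>)"

definition avg1 :: "(('a \<times> 'b) \<Rightarrow>\<^sub>C real) \<Rightarrow> (('a \<times> 'b) \<Rightarrow>\<^sub>C real)"
  where "avg1 h = Bcontfun (\<lambda>(x, y). \<integral>x'. h (x', y) \<partial>\<mu>)"

lemma abs_integral_section_le:
  fixes h :: "('a \<times> 'b) \<Rightarrow>\<^sub>C real"
  shows "\<bar>\<integral>y'. h (x, y') \<partial>\<nu>\<bar> \<le> norm h" "\<bar>\<integral>x'. h (x', y) \<partial>\<mu>\<bar> \<le> norm h"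
proof -
  have h: "- norm h \<le> h z" "h z \<le> norm h" for z using abs_apply_bcontfun_le[of h z] by auto
  show "\<bar>\<integral>y'. h (x, y') \<partial>\<nu>\<bar> \<le> norm h"
    unfolding abs_le_iff minus_le_iff[of _ "norm h"]
    by (intro conjI M2.integral_ge_const M2.integral_le_const integrable_section AE_I2 h)
  show "\<bar>\<integral>x'. h (x', y) \<partial>\<mu>\<bar> \<le> norm h"
    unfolding abs_le_iff minus_le_iff[of _ "norm h"]
    by (intro conjI M1.integral_ge_const M1.integral_le_const integrable_section AE_I2 h)
qed

text \<open>Continuity in the remaining variable is dominated convergence along sequences with the
  constant bound \<open>norm h\<close>; it is what makes the \<open>Bcontfun\<close> in the
  definition the intended function.\<close>

lemma apply_avg0 [simp]: "avg0 h (x, y) = (\<integral>y'. h (x, y') \<partial>\<nu>)"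
proof -
  have "continuous_on UNIV (\<lambda>x. \<integral>y'. h (x, y') \<partial>\<nu>)"
    unfolding continuous_on_sequentially comp_def
  proof safe
    fix X :: "nat \<Rightarrow> 'a" and a assume X: "X \<longlonglongrightarrow> a"
    show "(\<lambda>n. \<integral>y'. h (X n, y') \<partial>\<nu>) \<longlonglongrightarrow> (\<integral>y'. h (a, y') \<partial>\<nu>)"
    proof (rule integral_dominated_convergence[where w = "\<lambda>_. norm h"])
      show "AE y in \<nu>. (\<lambda>n. h (X n, y)) \<longlonglongrightarrow> h (a, y)"
        by (intro AE_I2 continuous_on_tendsto_compose[OF continuous_on_apply_bcontfun[of UNIV h]]
            tendsto_Pair X tendsto_const) auto
    qed (auto intro: measurable_section abs_apply_bcontfun_le)
  qed
  then have "continuous_on UNIV (\<lambda>(x, y :: 'b). \<integral>y'. h (x, y') \<partial>\<nu>)"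
    unfolding case_prod_unfold by (rule continuous_on_compose2) (auto intro: continuous_intros)
  then have "apply_bcontfun (avg0 h) = (\<lambda>(x, y :: 'b). \<integral>y'. h (x, y') \<partial>\<nu>)"
    unfolding avg0_def by (rule apply_Bcontfun) (auto intro: abs_integral_section_le)
  then show ?thesis by simp
qed

lemma apply_avg1 [simp]: "avg1 h (x, y) = (\<integral>x'. h (x', y) \<partial>\<mu>)"
proof -
  have "continuous_on UNIV (\<lambda>y. \<integral>x'. h (x', y) \<partial>\<mu>)"
    unfolding continuous_on_sequentially comp_def
  proof safe
    fix X :: "nat \<Rightarrow> 'b" and a assume X: "X \<longlonglongrightarrow> a"
    show "(\<lambda>n. \<integral>x'. h (x', X n) \<partial>\<mu>) \<longlonglongrightarrow> (\<integral>x'. h (x', a) \<partial>\<mu>)"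
    proof (rule integral_dominated_convergence[where w = "\<lambda>_. norm h"])
      show "AE x in \<mu>. (\<lambda>n. h (x, X n)) \<longlonglongrightarrow> h (x, a)"
        by (intro AE_I2 continuous_on_tendsto_compose[OF continuous_on_apply_bcontfun[of UNIV h]]
            tendsto_Pair X tendsto_const) auto
    qed (auto intro: measurable_section abs_apply_bcontfun_le)
  qed
  then have "continuous_on UNIV (\<lambda>(x :: 'a, y). \<integral>x'. h (x', y) \<partial>\<mu>)"
    unfolding case_prod_unfold by (rule continuous_on_compose2) (auto intro: continuous_intros)
  then have "apply_bcontfun (avg1 h) = (\<lambda>(x :: 'a, y). \<integral>x'. h (x', y) \<partial>\<mu>)"
    unfolding avg1_def by (rule apply_Bcontfun) (auto intro: abs_integral_section_le)
  then show ?thesis by simp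
qed

lemma integrable_bcontfun: "integrable (\<mu> \<Otimes>\<^sub>M \<nu>) (apply_bcontfun h)" for h :: "('a \<times> 'b) \<Rightarrow>\<^sub>C real"
  by (auto intro!: integrable_const_bound[of _ "norm h"] measurable_bcontfun abs_apply_bcontfun_le)

lemma avg_avg:
  "avg0 (avg1 h) z = (\<integral>z. h z \<partial>(\<mu> \<Otimes>\<^sub>M \<nu>))" "avg1 (avg0 h) z = (\<integral>z. h z \<partial>(\<mu> \<Otimes>\<^sub>M \<nu>))"
proof -
  obtain x y where z: "z = (x, y)" by (metis surj_pair)
  show "avg0 (avg1 h) z = (\<integral>z. h z \<partial>(\<mu> \<Otimes>\<^sub>M \<nu>))"
    using integral_snd[of "\<lambda>x y. h (x, y)"] integrable_bcontfun[of h] by (simp add: z)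
  show "avg1 (avg0 h) z = (\<integral>z. h z \<partial>(\<mu> \<Otimes>\<^sub>M \<nu>))"
    using integral_fst'[OF integrable_bcontfun[of h]] by (simp add: z)
qed

sublocale markov: two_markov avg0 avg1
proof unfold_locales
  fix f g h u :: "('a \<times> 'b) \<Rightarrow>\<^sub>C real" and c :: real and z
  show "avg0 (f + g) = avg0 f + avg0 g" "avg1 (f + g) = avg1 f + avg1 g"
    by (auto intro!: bcontfun_eqI simp: integrable_section)
  show "avg0 (c *\<^sub>R f) = c *\<^sub>R avg0 f" "avg1 (c *\<^sub>R f) = c *\<^sub>R avg1 f"
    by (auto intro!: bcontfun_eqI)
  show "avg0 (const_bcontfun 1) = const_bcontfun 1" "avg1 (const_bcontfun 1) = const_bcontfun 1"
    by (auto intro!: bcontfun_eqI simp: M1.prob_space M2.prob_space)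
  show "0 \<le> avg0 f z" "0 \<le> avg1 f z" if "\<And>z. 0 \<le> f z"
    using that by (cases z; simp)+
  show "fst_only (avg0 h)" "snd_only (avg1 h)" by (simp_all add: fst_only_def snd_only_def)
  show "avg0 (u \<odot> h) = u \<odot> avg0 h" if "fst_only u"
  proof (rule bcontfun_eqI, safe)
    fix x y
    have "u (x, y') * h (x, y') = u (x, y) * h (x, y')" for y'
      using fst_onlyD[OF that, of x y' y] by (simp only:)
    then show "avg0 (u \<odot> h) (x, y) = (u \<odot> avg0 h) (x, y)"
      by (simp only: apply_avg0 apply_bmul integral_mult_right_zero)
  qed
  show "avg1 (u \<odot> h) = u \<odot> avg1 h" if "snd_only u"
  proof (rule bcontfun_eqI, safe)
    fix x y
    have "u (x', y) * h (x', y) = u (x, y) * h (x', y)" for x'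
      using snd_onlyD[OF that, of x' y x] by (simp only:)
    then show "avg1 (u \<odot> h) (x, y) = (u \<odot> avg1 h) (x, y)"
      by (simp only: apply_avg1 apply_bmul integral_mult_right_zero)
  qed
  show "avg0 (avg1 h) = avg1 (avg0 h)" by (rule bcontfun_eqI) (simp add: avg_avg)
qed

section \<open>Couplings and relative entropy\<close>

lemma coupling_prob:
  assumes "\<pi> \<in> couplings \<mu> \<nu>" shows "prob_space \<pi>" "sets \<pi> = sets (\<mu> \<Otimes>\<^sub>M \<nu>)" "space \<pi> = UNIV"
proof -
  from assms have s: "sets \<pi> = sets (\<mu> \<Otimes>\<^sub>M \<nu>)" and d: "distr \<pi> \<mu> fst = \<mu>" by (auto simp: couplings_def)
  show "sets \<pi> = sets (\<mu> \<Otimes>\<^sub>M \<nu>)" by fact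
  show "space \<pi> = UNIV" using sets_eq_imp_space_eq[OF s] by (simp add: space_pair_measure space_\<mu> space_\<nu>)
  have "fst \<in> measurable \<pi> \<mu>" unfolding measurable_cong_sets[OF s refl] by simp
  then show "prob_space \<pi>" by (rule prob_space_distrD) (simp only: d M1.prob_space_axioms)
qed

lemma coupling_AE:
  assumes \<pi>: "\<pi> \<in> couplings \<mu> \<nu>"
  shows "AE x in \<mu>. P x \<Longrightarrow> AE z in \<pi>. P (fst z)" "AE y in \<nu>. Q y \<Longrightarrow> AE z in \<pi>. Q (snd z)"
proof -
  from \<pi> have s: "sets \<pi> = sets (\<mu> \<Otimes>\<^sub>M \<nu>)" and d: "distr \<pi> \<mu> fst = \<mu>" "distr \<pi> \<nu> snd = \<nu>"
    by (auto simp: couplings_def)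
  have m: "fst \<in> measurable \<pi> \<mu>" "snd \<in> measurable \<pi> \<nu>"
    unfolding measurable_cong_sets[OF s refl] by simp_all
  show "AE x in \<mu>. P x \<Longrightarrow> AE z in \<pi>. P (fst z)" by (rule AE_distrD[OF m(1)]) (simp only: d)
  show "AE y in \<nu>. Q y \<Longrightarrow> AE z in \<pi>. Q (snd z)" by (rule AE_distrD[OF m(2)]) (simp only: d)
qed

lemma integrable_coupling:
  fixes h :: "('a \<times> 'b) \<Rightarrow>\<^sub>C real"
  assumes "\<pi> \<in> couplings \<mu> \<nu>" shows "integrable \<pi> (apply_bcontfun h)"
proof -
  interpret \<pi>: prob_space \<pi> using coupling_prob[OF assms] by simp
  show ?thesis
    using measurable_bcontfun[of h] unfolding measurable_cong_sets[OF coupling_prob(2)[OF assms, symmetric] refl]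
    by (intro \<pi>.integrable_const_bound[of _ "norm h"]) (auto intro: abs_apply_bcontfun_le)
qed

lemma coupling_integral:
  fixes u v :: "('a \<times> 'b) \<Rightarrow>\<^sub>C real"
  assumes \<pi>: "\<pi> \<in> couplings \<mu> \<nu>"
  shows "fst_only u \<Longrightarrow> (\<integral>z. u z \<partial>\<pi>) = (\<integral>x. u (x, undefined) \<partial>\<mu>)"
    and "snd_only v \<Longrightarrow> (\<integral>z. v z \<partial>\<pi>) = (\<integral>y. v (undefined, y) \<partial>\<nu>)"
proof -
  from \<pi> have s: "sets \<pi> = sets (\<mu> \<Otimes>\<^sub>M \<nu>)" and d: "distr \<pi> \<mu> fst = \<mu>" "distr \<pi> \<nu> snd = \<nu>"
    by (auto simp: couplings_def)
  have m: "fst \<in> measurable \<pi> \<mu>" "snd \<in> measurable \<pi> \<nu>"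
    unfolding measurable_cong_sets[OF s refl] by simp_all
  have "(\<integral>z. u (fst z, undefined) \<partial>\<pi>) = (\<integral>x. u (x, undefined) \<partial>distr \<pi> \<mu> fst)"
    by (rule integral_distr[symmetric]) (auto intro: m measurable_section)
  moreover have "(\<integral>z. u z \<partial>\<pi>) = (\<integral>z. u (fst z, undefined) \<partial>\<pi>)" if "fst_only u"
    by (intro Bochner_Integration.integral_cong refl)
       (use fst_onlyD[OF that, of "fst z" "snd z" undefined for z] in \<open>simp only: prod.collapse\<close>)
  ultimately show "fst_only u \<Longrightarrow> (\<integral>z. u z \<partial>\<pi>) = (\<integral>x. u (x, undefined) \<partial>\<mu>)" using d by simp
  have "(\<integral>z. v (undefined, snd z) \<partial>\<pi>) = (\<integral>y. v (undefined, y) \<partial>distr \<pi> \<nu> snd)"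
    by (rule integral_distr[symmetric]) (auto intro: m measurable_section)
  moreover have "(\<integral>z. v z \<partial>\<pi>) = (\<integral>z. v (undefined, snd z) \<partial>\<pi>)" if "snd_only v"
    by (intro Bochner_Integration.integral_cong refl)
       (use snd_onlyD[OF that, of "fst z" "snd z" undefined for z] in \<open>simp only: prod.collapse\<close>)
  ultimately show "snd_only v \<Longrightarrow> (\<integral>z. v z \<partial>\<pi>) = (\<integral>y. v (undefined, y) \<partial>\<nu>)" using d by simp
qed

lemma E_fst_only: "fst_only u \<Longrightarrow> avg0 (avg1 u) z = (\<integral>x. u (x, undefined) \<partial>\<mu>)"
proof -
  assume u: "fst_only u"
  have "avg0 (avg1 u) z = avg1 u (undefined, undefined)"
    using markov.E_const[of u z "(undefined, undefined)"]
    unfolding markov.commute markov.M0_id[OF u] .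
  then show ?thesis by simp
qed

lemma E_snd_only: "snd_only v \<Longrightarrow> avg0 (avg1 v) z = (\<integral>y. v (undefined, y) \<partial>\<nu>)"
proof -
  assume v: "snd_only v"
  have "avg0 (avg1 v) z = avg0 v (undefined, undefined)"
    using markov.E_const[of v z "(undefined, undefined)"] unfolding markov.M1_id[OF v] .
  then show ?thesis by simp
qed

text \<open>A coupling integrates functions of one variable as its marginals do, so the potentials
  contribute the same for all couplings: zero for \<open>pot\<close>, the free energy for
  \<open>pot1\<close>.\<close>

lemma coupling_integral_gibbs:
  fixes f :: "('a \<times> 'b) \<Rightarrow>\<^sub>C real"
  assumes \<pi>: "\<pi> \<in> couplings \<mu> \<nu>"
  shows "(\<integral>z. (f - markov.pot f - markov.pot1 f) z \<partial>\<pi>) = (\<integral>z. f z \<partial>\<pi>) - markov.free_energy f"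
proof -
  have "(\<integral>z. markov.pot f z \<partial>\<pi>) = 0"
    using coupling_integral(1)[OF \<pi> markov.fst_only_pot] E_fst_only[OF markov.fst_only_pot, of f undefined]
    by (simp add: markov.E_pot)
  moreover have "(\<integral>z. markov.pot1 f z \<partial>\<pi>) = markov.free_energy f"
    using coupling_integral(2)[OF \<pi> markov.snd_only_pot1] E_snd_only[OF markov.snd_only_pot1, of f undefined]
    by (simp add: markov.free_energy_def)
  ultimately show ?thesis by (simp add: integrable_coupling[OF \<pi>])
qed

lemma apply_gibbs: "markov.gibbs f z = exp ((f - markov.pot f - markov.pot1 f) z)"
  by (simp add: markov.gibbs_def)

lemma integral_gibbs: "(\<integral>z. markov.gibbs f z \<partial>(\<mu> \<Otimes>\<^sub>M \<nu>)) = 1"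
  using avg_avg(1)[of "markov.gibbs f" undefined] by (simp add: markov.M1_gibbs markov.M0.const)

text \<open>Let \<open>g\<close> be the logarithm of the Gibbs density, \<open>D\<close> the density
  of \<pi> and \<open>q\<close> their ratio. Then \<open>1 + s \<le> exp s\<close> at
  \<open>s = g - ln D\<close> gives \<open>g - q + 1 \<le> ln D\<close>, and \<open>q\<close> has
  \<pi>-integral at most 1. An infinite divergence leaves nothing to show.\<close>

lemma KL_ext_ge:
  fixes f :: "('a \<times> 'b) \<Rightarrow>\<^sub>C real"
  assumes \<pi>: "\<pi> \<in> couplings \<mu> \<nu>"
  shows "ereal ((\<integral>z. f z \<partial>\<pi>) - markov.free_energy f) \<le> KL_ext \<pi> (\<mu> \<Otimes>\<^sub>M \<nu>)"
proof (cases "absolutely_continuous (\<mu> \<Otimes>\<^sub>M \<nu>) \<pi> \<and> integrable \<pi> (entropy_density (exp 1) (\<mu> \<Otimes>\<^sub>M \<nu>) \<pi>)")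
  case True
  let ?P = "\<mu> \<Otimes>\<^sub>M \<nu>" and ?g = "f - markov.pot f - markov.pot1 f"
  interpret \<pi>: prob_space \<pi> using coupling_prob[OF \<pi>] by simp
  have s: "sets \<pi> = sets ?P" using coupling_prob[OF \<pi>] by simp
  obtain D where D: "D \<in> borel_measurable ?P" "AE z in ?P. RN_deriv ?P \<pi> z = ennreal (D z)"
    "AE z in \<pi>. 0 < D z" "\<And>z. 0 \<le> D z"
    using real_RN_deriv[OF \<pi>.finite_measure_axioms _ s] True by blast
  have "\<pi> = density ?P (RN_deriv ?P \<pi>)" using density_RN_deriv[of \<pi>] True s by simp
  also have "\<dots> = density ?P (\<lambda>z. ennreal (D z))" by (rule density_cong) (use D in auto)
  finally have \<pi>D: "\<pi> = density ?P (\<lambda>z. ennreal (D z))" .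
  have "AE z in \<pi>. RN_deriv ?P \<pi> z = ennreal (D z)"
    by (rule absolutely_continuous_AE[OF s _ D(2)]) (use True in simp)
  then have ent: "AE z in \<pi>. entropy_density (exp 1) ?P \<pi> z = ln (D z)"
    by eventually_elim (simp add: entropy_density_def log_def D(4))
  let ?q = "\<lambda>z. markov.gibbs f z / D z"
  have g_meas: "?q \<in> borel_measurable ?P" using D(1) measurable_bcontfun by simp
  \<comment> \<open>Only an inequality: where \<open>D z = 0\<close> the quotient is 0 by
    convention, and the Gibbs mass there is lost.\<close>
  have gle: "D z * ?q z \<le> markov.gibbs f z" "0 \<le> D z * ?q z" for z
    using D(4)[of z] by (cases "D z = 0", auto simp: apply_gibbs)
  have int_Dq: "integrable ?P (\<lambda>z. D z * ?q z)"
    by (rule Bochner_Integration.integrable_bound[OF integrable_bcontfun[of "markov.gibbs f"]])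
       (use gle order_trans[OF gle(2) gle(1)] in \<open>intro AE_I2 borel_measurable_times D(1) g_meas, simp only: real_norm_def abs_of_nonneg, simp\<close>)
  have int_q: "integrable \<pi> ?q"
    by (subst \<pi>D, subst integrable_density) (use g_meas D int_Dq in auto)
  have "(\<integral>z. ?q z \<partial>\<pi>) = (\<integral>z. D z * ?q z \<partial>?P)"
    by (subst \<pi>D, subst integral_density) (use g_meas D in auto)
  also have "\<dots> \<le> (\<integral>z. markov.gibbs f z \<partial>?P)"
    by (rule integral_mono[OF int_Dq integrable_bcontfun gle(1)])
  finally have q1: "(\<integral>z. ?q z \<partial>\<pi>) \<le> 1" by (simp add: integral_gibbs)
  have "(\<integral>z. ?g z - ?q z + 1 \<partial>\<pi>) \<le> (\<integral>z. entropy_density (exp 1) ?P \<pi> z \<partial>\<pi>)"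
  proof (rule integral_mono_AE)
    show "AE z in \<pi>. ?g z - ?q z + 1 \<le> entropy_density (exp 1) ?P \<pi> z"
      using ent D(3)
    proof eventually_elim
      case (elim z)
      have "1 + (?g z - ln (D z)) \<le> exp (?g z - ln (D z))" by (rule exp_ge_add_one_self)
      also have "\<dots> = ?q z" using elim by (simp add: apply_gibbs exp_diff)
      finally have "?g z - ?q z + 1 \<le> ln (D z)" by linarith
      then show ?case using elim by simp
    qed
  qed (use True int_q integrable_coupling[OF \<pi>, of ?g] in auto)
  also have "(\<integral>z. ?g z - ?q z + 1 \<partial>\<pi>) = (\<integral>z. ?g z \<partial>\<pi>) - (\<integral>z. ?q z \<partial>\<pi>) + 1"
    using int_q integrable_coupling[OF \<pi>, of ?g] \<pi>.prob_space by simp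
  finally have "(\<integral>z. f z \<partial>\<pi>) - markov.free_energy f \<le> KL_divergence (exp 1) ?P \<pi>"
    using q1 unfolding coupling_integral_gibbs[OF \<pi>] KL_divergence_def by linarith
  with True show ?thesis by (simp add: KL_ext_def)
qed (auto simp: KL_ext_def)

text \<open>Equality in \<open>KL_ext_ge\<close>: the logarithm of the density is the very function
  whose integral \<open>coupling_integral_gibbs\<close> evaluates. The marginals come from Tonelli's
  theorem, each section of the density having integral 1.\<close>

lemma gibbs_coupling:
  fixes f :: "('a \<times> 'b) \<Rightarrow>\<^sub>C real"
  defines "\<gamma> \<equiv> \<lambda>f. density (\<mu> \<Otimes>\<^sub>M \<nu>) (\<lambda>z. ennreal (markov.gibbs f z))"
  shows "\<gamma> f \<in> couplings \<mu> \<nu>"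
    and "KL_ext (\<gamma> f) (\<mu> \<Otimes>\<^sub>M \<nu>) = ereal ((\<integral>z. f z \<partial>\<gamma> f) - markov.free_energy f)"
proof -
  let ?P = "\<mu> \<Otimes>\<^sub>M \<nu>" and ?g = "f - markov.pot f - markov.pot1 f"
  have [measurable]: "(\<lambda>z. markov.gibbs f z) \<in> borel_measurable ?P" by (rule measurable_bcontfun)
  have pos: "0 \<le> markov.gibbs f z" for z by (simp add: apply_gibbs)
  have sec: "(\<integral>\<^sup>+y. ennreal (markov.gibbs f (x, y)) \<partial>\<nu>) = 1" for x
    using markov.M0_gibbs[of f] apply_avg0[of "markov.gibbs f" x undefined]
    by (subst nn_integral_eq_integral) (auto simp: integrable_section pos)
  have sec': "(\<integral>\<^sup>+x. ennreal (markov.gibbs f (x, y)) \<partial>\<mu>) = 1" for y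
    using markov.M1_gibbs[of f] apply_avg1[of "markov.gibbs f" undefined y]
    by (subst nn_integral_eq_integral) (auto simp: integrable_section pos)
  have ms: "(\<lambda>y. ennreal (markov.gibbs f (x, y))) \<in> borel_measurable \<nu>"
    "(\<lambda>x. ennreal (markov.gibbs f (x, y))) \<in> borel_measurable \<mu>" for x y
    using measurable_section by measurable
  show \<gamma>: "\<gamma> f \<in> couplings \<mu> \<nu>"
    unfolding couplings_def mem_Collect_eq
  proof (intro conjI)
    show "sets (\<gamma> f) = sets ?P" by (simp add: \<gamma>_def)
    have mf: "fst \<in> measurable (\<gamma> f) \<mu>" "snd \<in> measurable (\<gamma> f) \<nu>" by (simp_all add: \<gamma>_def)
    show "distr (\<gamma> f) \<mu> fst = \<mu>"
    proof (rule measure_eqI)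
      fix A assume "A \<in> sets (distr (\<gamma> f) \<mu> fst)"
      then have A [measurable]: "A \<in> sets \<mu>" by simp
      have "emeasure (distr (\<gamma> f) \<mu> fst) A = emeasure (\<gamma> f) (A \<times> UNIV)"
      proof -
        have "fst -` A \<inter> space (\<gamma> f) = A \<times> UNIV"
          by (auto simp: \<gamma>_def space_pair_measure space_\<mu> space_\<nu>)
        then show ?thesis by (simp only: emeasure_distr[OF mf(1) A])
      qed
      also have "\<dots> = (\<integral>\<^sup>+z. ennreal (markov.gibbs f z) * indicator (A \<times> UNIV) z \<partial>?P)"
        unfolding \<gamma>_def using A sets.top[of \<nu>] by (subst emeasure_density) (auto simp: space_\<nu>)
      also have "\<dots> = (\<integral>\<^sup>+x. \<integral>\<^sup>+y. ennreal (markov.gibbs f (x, y)) * indicator (A \<times> UNIV) (x, y) \<partial>\<nu> \<partial>\<mu>)"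
        using A sets.top[of \<nu>] by (intro M2.nn_integral_fst[symmetric]) (auto simp: space_\<nu> intro!: borel_measurable_times_ennreal borel_measurable_indicator)
      also have "\<dots> = (\<integral>\<^sup>+x. indicator A x \<partial>\<mu>)"
        by (intro nn_integral_cong) (auto simp: indicator_times nn_integral_multc ms sec)
      finally show "emeasure (distr (\<gamma> f) \<mu> fst) A = emeasure \<mu> A" by simp
    qed simp
    show "distr (\<gamma> f) \<nu> snd = \<nu>"
    proof (rule measure_eqI)
      fix A assume "A \<in> sets (distr (\<gamma> f) \<nu> snd)"
      then have A [measurable]: "A \<in> sets \<nu>" by simp
      have "emeasure (distr (\<gamma> f) \<nu> snd) A = emeasure (\<gamma> f) (UNIV \<times> A)"
      proof -
        have "snd -` A \<inter> space (\<gamma> f) = UNIV \<times> A"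
          by (auto simp: \<gamma>_def space_pair_measure space_\<mu> space_\<nu>)
        then show ?thesis by (simp only: emeasure_distr[OF mf(2) A])
      qed
      also have "\<dots> = (\<integral>\<^sup>+z. ennreal (markov.gibbs f z) * indicator (UNIV \<times> A) z \<partial>?P)"
        unfolding \<gamma>_def using A sets.top[of \<mu>] by (subst emeasure_density) (auto simp: space_\<mu>)
      also have "\<dots> = (\<integral>\<^sup>+y. \<integral>\<^sup>+x. ennreal (markov.gibbs f (x, y)) * indicator (UNIV \<times> A) (x, y) \<partial>\<mu> \<partial>\<nu>)"
        using A sets.top[of \<mu>] by (intro nn_integral_snd[symmetric]) (auto simp: space_\<mu> intro!: borel_measurable_times_ennreal borel_measurable_indicator)
      also have "\<dots> = (\<integral>\<^sup>+y. indicator A y \<partial>\<nu>)"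
        by (intro nn_integral_cong) (auto simp: indicator_times nn_integral_multc ms sec')
      finally show "emeasure (distr (\<gamma> f) \<nu> snd) A = emeasure \<nu> A" by simp
    qed simp
  qed
  have ac: "absolutely_continuous ?P (\<gamma> f)"
    unfolding \<gamma>_def by (rule absolutely_continuousI_density) simp
  have "AE z in ?P. ennreal (markov.gibbs f z) = RN_deriv ?P (\<gamma> f) z"
    by (rule RN_deriv_unique) (auto simp: \<gamma>_def)
  from absolutely_continuous_AE[OF coupling_prob(2)[OF \<gamma>] ac this]
  have ent: "AE z in \<gamma> f. entropy_density (exp 1) ?P (\<gamma> f) z = ?g z"
  proof eventually_elim
    case (elim z)
    then show ?case using pos[of z]
      by (simp add: entropy_density_def log_def apply_gibbs flip: elim)
  qed
  have em: "entropy_density (exp 1) ?P (\<gamma> f) \<in> borel_measurable (\<gamma> f)"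
    using measurable_entropy_density[of "exp 1" ?P "\<gamma> f"] by (simp add: \<gamma>_def)
  have "integrable (\<gamma> f) (entropy_density (exp 1) ?P (\<gamma> f))"
    using integrable_cong_AE[OF em _ ent] integrable_coupling[OF \<gamma>, of ?g] by blast
  moreover have "KL_divergence (exp 1) ?P (\<gamma> f) = (\<integral>z. ?g z \<partial>\<gamma> f)"
    unfolding KL_divergence_def
    using integral_cong_AE[OF em _ ent] integrable_coupling[OF \<gamma>, of ?g] by blast
  ultimately show "KL_ext (\<gamma> f) ?P = ereal ((\<integral>z. f z \<partial>\<gamma> f) - markov.free_energy f)"
    using ac by (simp only: KL_ext_def coupling_integral_gibbs[OF \<gamma>] if_True simp_thms)
qed

end

section \<open>Eigenvalues of symmetric matrices\<close>

lemma inner_matrix_vector_symmetric: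
  fixes H :: "real ^ 'k ^ 'k"
  assumes "transpose H = H" shows "v \<bullet> (H *v w) = w \<bullet> (H *v v)"
  using assms by (metis dot_lmul_matrix inner_commute transpose_matrix_vector)

text \<open>Eigenvectors of distinct eigenvalues are orthogonal, hence independent. Finiteness gives
  \<open>Max\<close> and \<open>Min\<close> in \<open>lambda_max\<close> and
  \<open>lambda_min\<close> their meaning.\<close>

lemma finite_eigenvalues:
  fixes H :: "real ^ 'k ^ 'k"
  assumes H: "transpose H = H" shows "finite (eigenvalues H)"
proof -
  have "\<forall>l\<in>eigenvalues H. \<exists>v. v \<noteq> 0 \<and> H *v v = l *\<^sub>R v" by (auto simp: eigenvalues_def)
  then obtain e where e: "\<And>l. l \<in> eigenvalues H \<Longrightarrow> e l \<noteq> 0 \<and> H *v e l = l *\<^sub>R e l" by metis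
  have orth: "e l \<bullet> e m = 0" if "l \<in> eigenvalues H" "m \<in> eigenvalues H" "l \<noteq> m" for l m
    using inner_matrix_vector_symmetric[OF H, of "e l" "e m"] e that by (simp add: inner_commute)
  have inj: "inj_on e (eigenvalues H)"
    using orth e by (metis inj_onI inner_eq_zero_iff)
  have "pairwise orthogonal (e ` eigenvalues H)"
    using orth by (auto simp: pairwise_def orthogonal_def)
  moreover have "0 \<notin> e ` eigenvalues H" using e by auto
  ultimately have "finite (e ` eigenvalues H)"
    using pairwise_orthogonal_independent independent_imp_finite by blast
  then show ?thesis using inj finite_imageD by blast
qed

text \<open>A maximizer of the Rayleigh quotient is an eigenvector: the form \<open>l * (norm v)\<^sup>2 - v \<bullet> (H *v v)\<close>
  is positive semidefinite and vanishes at the maximizer, which therefore lies in its kernel.\<close>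

lemma rayleigh_max:
  fixes H :: "real ^ 'k ^ 'k"
  assumes H: "transpose H = H"
  obtains l v where "norm v = 1" "H *v v = l *\<^sub>R v" "\<And>w. w \<bullet> (H *v w) \<le> l * (norm w)\<^sup>2"
proof -
  have "continuous_on (sphere 0 1) (\<lambda>v. v \<bullet> (H *v v))"
    by (intro continuous_intros linear_continuous_on matrix_vector_mul_bounded_linear)
  moreover have "sphere (0 :: real ^ 'k) 1 \<noteq> {}" by simp
  ultimately obtain v where v: "v \<in> sphere 0 1" and max: "\<And>w. w \<in> sphere 0 1 \<Longrightarrow> w \<bullet> (H *v w) \<le> v \<bullet> (H *v v)"
    using continuous_attains_sup[OF compact_sphere, of 0 1 "\<lambda>v. v \<bullet> (H *v v)"] by blast
  define l where "l = v \<bullet> (H *v v)"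
  have le: "w \<bullet> (H *v w) \<le> l * (norm w)\<^sup>2" for w
  proof (cases "w = 0")
    case False
    have "(w /\<^sub>R norm w) \<bullet> (H *v (w /\<^sub>R norm w)) \<le> l"
      unfolding l_def by (rule max) (use False in simp)
    then have "(w \<bullet> (H *v w)) / (norm w)\<^sup>2 \<le> l"
      by (simp add: matrix_vector_mult_scaleR power2_eq_square divide_inverse mult_ac)
    then show ?thesis using False by (simp add: divide_le_eq)
  qed simp
  define r where "r = H *v v - l *\<^sub>R v"
  have nv: "norm v = 1" "v \<bullet> v = 1" using v by (auto simp: norm_eq_1)
  have "r = 0"
  proof (rule ccontr)
    assume "r \<noteq> 0"
    define a where "a = r \<bullet> r"
    define b where "b = \<bar>l * (norm r)\<^sup>2 - r \<bullet> (H *v r)\<bar> + 1"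
    have a: "a > 0" using \<open>r \<noteq> 0\<close> by (simp add: a_def)
    have b: "b > 0" by (simp add: b_def add_nonneg_pos)
    \<comment> \<open>At this step length the quadratic term is at most \<open>t * a\<close>,
      against a linear term \<open>2 * t * a\<close>; the \<open>+ 1\<close> in \<open>b\<close>
      keeps the denominator positive.\<close>
    define t where "t = a / b"
    have t: "t > 0" using a b by (simp add: t_def)
    have "(v + t *\<^sub>R r) \<bullet> (H *v (v + t *\<^sub>R r)) \<le> l * (norm (v + t *\<^sub>R r))\<^sup>2" by (rule le)
    moreover have "(v + t *\<^sub>R r) \<bullet> (H *v (v + t *\<^sub>R r)) = l + 2 * t * (r \<bullet> (H *v v)) + t\<^sup>2 * (r \<bullet> (H *v r))"
      using inner_matrix_vector_symmetric[OF H, of v r]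
      by (simp add: matrix_vector_mult_scaleR matrix_vector_right_distrib inner_left_distrib inner_right_distrib l_def power2_eq_square algebra_simps)
    moreover have "(norm (v + t *\<^sub>R r))\<^sup>2 = 1 + 2 * t * (r \<bullet> v) + t\<^sup>2 * (norm r)\<^sup>2"
      using nv unfolding power2_norm_eq_inner
      by (simp add: inner_left_distrib inner_right_distrib inner_commute power2_eq_square algebra_simps)
    moreover have "r \<bullet> (H *v v) = a + l * (r \<bullet> v)"
      unfolding a_def by (subst (2) r_def) (simp add: inner_diff_right)
    ultimately have "2 * t * a \<le> t\<^sup>2 * (l * (norm r)\<^sup>2 - r \<bullet> (H *v r))"
      by (simp add: algebra_simps)
    also have "\<dots> \<le> t\<^sup>2 * b" unfolding b_def by (intro mult_left_mono) auto
    also have "\<dots> = t * a" using b by (simp add: t_def power2_eq_square)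
    finally show False using t a by simp
  qed
  then have "H *v v = l *\<^sub>R v" by (simp add: r_def)
  from that[OF nv(1) this le] show ?thesis .
qed

lemma lambda_max_rayleigh:
  fixes H :: "real ^ 'k ^ 'k"
  assumes H: "transpose H = H"
  shows "w \<bullet> (H *v w) \<le> lambda_max H * (norm w)\<^sup>2"
    and "\<exists>v. norm v = 1 \<and> v \<bullet> (H *v v) = lambda_max H"
proof -
  obtain l v where v: "norm v = 1" "H *v v = l *\<^sub>R v" and le: "\<And>w. w \<bullet> (H *v w) \<le> l * (norm w)\<^sup>2"
    using rayleigh_max[OF H] by blast
  have "lambda_max H = l"
    unfolding lambda_max_def
  proof (rule Max_eqI[OF finite_eigenvalues[OF H]])
    have "v \<noteq> 0" using v by auto
    then show "l \<in> eigenvalues H" using v by (auto simp: eigenvalues_def)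
    fix m assume "m \<in> eigenvalues H"
    then obtain w where w: "w \<noteq> 0" "H *v w = m *\<^sub>R w" by (auto simp: eigenvalues_def)
    then have "m * (norm w)\<^sup>2 \<le> l * (norm w)\<^sup>2" using le[of w] by (simp add: power2_norm_eq_inner)
    then show "m \<le> l" using w by simp
  qed
  then show "w \<bullet> (H *v w) \<le> lambda_max H * (norm w)\<^sup>2" "\<exists>v. norm v = 1 \<and> v \<bullet> (H *v v) = lambda_max H"
    using le v by (auto simp: norm_eq_1)
qed

lemma matrix_vector_mult_uminus: "(- H) *v v = - (H *v v)" for H :: "real ^ 'n ^ 'm"
  by (simp add: matrix_vector_mult_def vec_eq_iff sum_negf)

lemma lambda_min_eq: 
  fixes H :: "real ^ 'k ^ 'k"
  assumes H: "transpose H = H"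
  shows "lambda_min H = - lambda_max (- H)"
proof -
  have e: "eigenvalues (- H) = uminus ` eigenvalues H"
    unfolding eigenvalues_def matrix_vector_mult_uminus
    by (auto simp: image_iff) (metis minus_equation_iff scaleR_minus_left)+
  obtain l v where v: "norm v = 1" "H *v v = l *\<^sub>R v" using rayleigh_max[OF H] by blast
  then have "v \<noteq> 0" by auto
  with v have "l \<in> eigenvalues H" by (auto simp: eigenvalues_def)
  then have ne: "eigenvalues H \<noteq> {}" by blast
  have "Max (uminus ` eigenvalues H) = - Min (eigenvalues H)"
    using finite_eigenvalues[OF H] ne by (intro Max_eqI) auto
  then show ?thesis by (simp add: lambda_min_def lambda_max_def e)
qed

text \<open>Attainment holds because \<open>\<bar>lambda_max H\<bar>\<close> and
  \<open>\<bar>lambda_min H\<bar>\<close> are both at most \<open>m\<close> and one of them equals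
  it. The form \<open>\<bar>w \<bullet> (H *v w)\<bar>\<close> is what compactness arguments can
  handle.\<close>

lemma spectral_radius_rayleigh:
  fixes H :: "real ^ 'k ^ 'k"
  assumes H: "transpose H = H"
  defines "m \<equiv> max (lambda_max H) (- lambda_min H)"
  shows "\<bar>w \<bullet> (H *v w)\<bar> \<le> m * (norm w)\<^sup>2" and "\<exists>v. norm v = 1 \<and> \<bar>v \<bullet> (H *v v)\<bar> = m"
proof -
  have H': "transpose (- H) = - H" using H by (simp add: transpose_def vec_eq_iff)
  have bound: "\<bar>w \<bullet> (H *v w)\<bar> \<le> m * (norm w)\<^sup>2" for w
  proof -
    have "w \<bullet> (H *v w) \<le> lambda_max H * (norm w)\<^sup>2" by (rule lambda_max_rayleigh(1)[OF H])
    moreover have "- (w \<bullet> (H *v w)) \<le> - lambda_min H * (norm w)\<^sup>2"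
      using lambda_max_rayleigh(1)[OF H', of w] by (simp add: matrix_vector_mult_uminus lambda_min_eq[OF H])
    moreover have "lambda_max H * (norm w)\<^sup>2 \<le> m * (norm w)\<^sup>2" "- lambda_min H * (norm w)\<^sup>2 \<le> m * (norm w)\<^sup>2"
      by (intro mult_right_mono; simp add: m_def)+
    ultimately show ?thesis by linarith
  qed
  then show "\<bar>w \<bullet> (H *v w)\<bar> \<le> m * (norm w)\<^sup>2" .
  obtain v where v: "norm v = 1" "v \<bullet> (H *v v) = lambda_max H" using lambda_max_rayleigh(2)[OF H] by blast
  obtain u where u: "norm u = 1" "u \<bullet> (H *v u) = lambda_min H"
    using lambda_max_rayleigh(2)[OF H'] by (auto simp: matrix_vector_mult_uminus lambda_min_eq[OF H])
  have "\<bar>lambda_max H\<bar> \<le> m" "\<bar>lambda_min H\<bar> \<le> m" using bound[of v] bound[of u] u v by auto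
  then have "\<bar>lambda_max H\<bar> = m \<or> \<bar>lambda_min H\<bar> = m" unfolding m_def by linarith
  then show "\<exists>v. norm v = 1 \<and> \<bar>v \<bullet> (H *v v)\<bar> = m" using u v by auto
qed

section \<open>Second derivatives and curvature bounds\<close>

text \<open>Differentiability of \<open>f'\<close> is assumed only in each fixed direction
  \<open>w\<close>; in finite dimension, expansion over \<open>Basis\<close> upgrades it to
  differentiability of \<open>frechet_D f\<close> as a map into bounded linear forms.\<close>

locale twice_derivative =
  fixes f :: "'a::euclidean_space \<Rightarrow> real" and f' :: "'a \<Rightarrow> 'a \<Rightarrow> real" and f'' :: "'a \<Rightarrow> 'a \<Rightarrow> 'a \<Rightarrow> real"
  assumes d1: "(f has_derivative f' x) (at x)"
    and d2: "((\<lambda>x. f' x w) has_derivative (\<lambda>v. f'' x v w)) (at x)"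
    and sym: "f'' x v w = f'' x w v"
begin

lemma linear1: "bounded_linear (f' x)" by (rule has_derivative_bounded_linear[OF d1])

lemma linear_left: "linear (\<lambda>v. f'' x v w)" by (rule has_derivative_linear[OF d2])

lemma linear_right: "linear (f'' x v)"
proof -
  have "f'' x v = (\<lambda>w. f'' x w v)" by (rule ext) (rule sym)
  then show ?thesis using linear_left[of x v] by simp
qed

lemma linear_sum_Basis: "linear g \<Longrightarrow> (\<Sum>b\<in>Basis. g b * (w \<bullet> b)) = g w" for g :: "'a \<Rightarrow> real"
  by (subst (2) euclidean_representation[symmetric, of w])
     (simp only: linear_sum linear_cmul o_def real_scaleR_def mult.commute)

lemma frechet_D_eq: "frechet_D f x = (\<Sum>b\<in>Basis. f' x b *\<^sub>R blinfun_inner_right b)"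
proof (rule blinfun_eqI)
  fix w
  have "frechet_derivative f (at x) = f' x" using frechet_derivative_at[OF d1] by simp
  then have "blinfun_apply (frechet_D f x) w = f' x w"
    using linear1 by (simp add: frechet_D_def bounded_linear_Blinfun_apply)
  also have "\<dots> = (\<Sum>b\<in>Basis. f' x b * (w \<bullet> b))"
    by (rule linear_sum_Basis[symmetric]) (rule bounded_linear.linear[OF linear1])
  finally show "blinfun_apply (frechet_D f x) w = blinfun_apply (\<Sum>b\<in>Basis. f' x b *\<^sub>R blinfun_inner_right b) w"
    by (simp add: blinfun.sum_left blinfun.scaleR_left inner_commute)
qed

lemma has_derivative_frechet_D:
  "(frechet_D f has_derivative (\<lambda>v. \<Sum>b\<in>Basis. f'' x v b *\<^sub>R blinfun_inner_right b)) (at x)"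
  unfolding frechet_D_eq[abs_def]
  by (intro has_derivative_sum bounded_linear.has_derivative[OF bounded_linear_scaleR_left] d2)

lemma twice_frechet_differentiable: "twice_frechet_differentiable_at f x"
  unfolding twice_frechet_differentiable_at_def differentiable_def
  using d1 has_derivative_frechet_D by (auto intro!: always_eventually)

lemma frechet_D2_eq: "frechet_D2 f x v w = f'' x v w"
proof -
  have "frechet_derivative (frechet_D f) (at x) v = (\<Sum>b\<in>Basis. f'' x v b *\<^sub>R blinfun_inner_right b)"
    using frechet_derivative_at[OF has_derivative_frechet_D] by metis
  then show ?thesis
    using linear_sum_Basis[OF linear_right, of x v w]
    by (simp add: frechet_D2_def blinfun.sum_left blinfun.scaleR_left inner_commute)
qed

text \<open>The second derivative test along the segment from \<open>x\<close> to \<open>y\<close>,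
  where adding the quadratic contributes \<open>\<rho> * (d \<bullet> d)\<close>. The sign of \<rho>
  is free; a negative one later yields strict convexity.\<close>

lemma weakly_convexI:
  assumes low: "\<And>x v. - \<rho> * (norm v)\<^sup>2 \<le> f'' x v v" shows "weakly_convex \<rho> f"
  unfolding weakly_convex_def convex_on_def
proof (intro conjI ballI allI impI convex_UNIV)
  fix x y :: 'a and u v :: real assume uv: "0 \<le> u" "0 \<le> v" "u + v = 1"
  define d where "d = y - x"
  define c where "c s = x + s *\<^sub>R d" for s
  define h where "h s = f (c s) + \<rho> / 2 * (norm (c s))\<^sup>2" for s
  define h' where "h' s = f' (c s) d + \<rho> * (c s \<bullet> d)" for s
  define h'' where "h'' s = f'' (c s) d d + \<rho> * (d \<bullet> d)" for s
  have c: "(c has_derivative (\<lambda>t. t *\<^sub>R d)) (at s)" for s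
    unfolding c_def by (auto intro!: derivative_eq_intros)
  have "DERIV h s :> h' s" for s
  proof -
    have "((\<lambda>s. f (c s) + \<rho> / 2 * (c s \<bullet> c s)) has_derivative
        (\<lambda>t. f' (c s) (t *\<^sub>R d) + \<rho> / 2 * (c s \<bullet> (t *\<^sub>R d) + t *\<^sub>R d \<bullet> c s))) (at s)"
      by (intro derivative_intros has_derivative_compose[OF c d1] c)
    then show ?thesis
      unfolding h_def h'_def has_field_derivative_def power2_norm_eq_inner
      by (rule has_derivative_eq_rhs)
         (auto simp: linear_cmul[OF bounded_linear.linear[OF linear1]] inner_commute algebra_simps)
  qed
  moreover have "DERIV h' s :> h'' s" for s
  proof -
    have "((\<lambda>s. f' (c s) d + \<rho> * (c s \<bullet> d)) has_derivative
        (\<lambda>t. f'' (c s) (t *\<^sub>R d) d + \<rho> * (c s \<bullet> 0 + t *\<^sub>R d \<bullet> d))) (at s)"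
      by (intro derivative_intros has_derivative_compose[OF c d2] c)
    then show ?thesis
      unfolding h'_def h''_def has_field_derivative_def
      by (rule has_derivative_eq_rhs) (auto simp: linear_cmul[OF linear_left] algebra_simps)
  qed
  moreover have "0 \<le> h'' s" for s
    using low[of d "c s"] by (simp add: h''_def power2_norm_eq_inner)
  ultimately have "convex_on UNIV h" by (intro f''_ge0_imp_convex) auto
  then have "h (u *\<^sub>R 0 + v *\<^sub>R 1) \<le> u * h 0 + v * h 1"
    using uv unfolding convex_on_def by blast
  moreover have "c v = u *\<^sub>R x + v *\<^sub>R y"
  proof -
    have "c v = (1 - v) *\<^sub>R x + v *\<^sub>R y" by (simp add: c_def d_def algebra_simps)
    also have "1 - v = u" using uv by simp
    finally show ?thesis .
  qed
  ultimately show "f (u *\<^sub>R x + v *\<^sub>R y) + \<rho> / 2 * (norm (u *\<^sub>R x + v *\<^sub>R y))\<^sup>2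
      \<le> u * (f x + \<rho> / 2 * (norm x)\<^sup>2) + v * (f y + \<rho> / 2 * (norm y)\<^sup>2)"
    by (simp add: h_def) (simp add: c_def d_def)
qed

text \<open>Polarization of normalized vectors and the parallelogram identity: passing from the
  quadratic to the bilinear form costs nothing in \<open>L\<close>.\<close>

lemma bilinear_le:
  assumes quad: "\<And>v. \<bar>f'' x v v\<bar> \<le> L * (norm v)\<^sup>2"
  shows "\<bar>f'' x v w\<bar> \<le> L * norm v * norm w"
proof (cases "v = 0 \<or> w = 0")
  case True
  then show ?thesis using linear_0[OF linear_left] linear_0[OF linear_right] by auto
next
  case False
  define a b where "a = v /\<^sub>R norm v" and "b = w /\<^sub>R norm w"
  have n: "norm a = 1" "norm b = 1" using False by (auto simp: a_def b_def)
  have "4 * f'' x a b = f'' x (a + b) (a + b) - f'' x (a - b) (a - b)"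
    using sym[of x a b]
    by (simp add: linear_add[OF linear_left] linear_add[OF linear_right] linear_diff[OF linear_left] linear_diff[OF linear_right])
  moreover have "L * (norm (a + b))\<^sup>2 + L * (norm (a - b))\<^sup>2 = 4 * L"
    using n by (simp add: power2_norm_eq_inner norm_eq_1 inner_left_distrib inner_right_distrib inner_diff_left inner_diff_right algebra_simps)
  ultimately have "\<bar>f'' x a b\<bar> \<le> L" using quad[of "a + b"] quad[of "a - b"] by linarith
  moreover have "f'' x v w = norm v * norm w * f'' x a b"
    using False by (simp add: a_def b_def linear_cmul[OF linear_left] linear_cmul[OF linear_right] field_simps)
  ultimately show ?thesis
    using mult_left_mono[of "\<bar>f'' x a b\<bar>" L "norm v * norm w"] by (simp add: abs_mult mult_ac)
qed

lemma L_smooth_onI: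
  assumes "convex S" and quad: "\<And>x v. x \<in> S \<Longrightarrow> \<bar>f'' x v v\<bar> \<le> L * (norm v)\<^sup>2" and "L \<ge> 0"
  shows "L_smooth_on L S f"
  unfolding L_smooth_on_def
proof (intro exI conjI ballI)
  define g where "g x = (\<Sum>b\<in>Basis. f' x b *\<^sub>R b)" for x
  show "GDERIV f x :> g x" for x
  proof -
    have "f' x w = w \<bullet> g x" for w
      using linear_sum_Basis[OF bounded_linear.linear[OF linear1], of x w]
      by (simp add: g_def inner_sum_right)
    then have "f' x = (\<lambda>w. w \<bullet> g x)" by (rule ext)
    then show ?thesis using d1[of x] by (simp add: gderiv_def)
  qed
  define T where "T x v = (\<Sum>b\<in>Basis. f'' x v b *\<^sub>R b)" for x v
  have g': "(g has_derivative T x) (at x)" for x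
    unfolding g_def[abs_def] T_def[abs_def]
    by (intro has_derivative_sum bounded_linear.has_derivative[OF bounded_linear_scaleR_left] d2)
  show "L-lipschitz_on S g"
  proof (rule lipschitz_onI)
    fix x y assume xy: "x \<in> S" "y \<in> S"
    have "norm (g x - g y) \<le> L * norm (x - y)"
    proof (rule differentiable_bound[OF \<open>convex S\<close>, where f' = T])
      fix x assume x: "x \<in> S"
      show "(g has_derivative T x) (at x within S)" using g' by (rule has_derivative_at_withinI)
      show "onorm (T x) \<le> L"
      proof (rule onorm_bound[OF \<open>L \<ge> 0\<close>])
        fix v
        have "T x v \<bullet> T x v = f'' x v (T x v)"
          using linear_sum_Basis[OF linear_right, of x v "T x v"]
          by (subst (2) T_def) (simp add: inner_sum_right inner_commute)
        also have "\<dots> \<le> L * norm v * norm (T x v)"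
          using bilinear_le[OF quad[OF x], of v "T x v"] by linarith
        finally have "norm (T x v) * norm (T x v) \<le> (L * norm v) * norm (T x v)"
          by (simp add: power2_norm_eq_inner[symmetric] power2_eq_square)
        then show "norm (T x v) \<le> L * norm v"
          using \<open>L \<ge> 0\<close> by (cases "T x v = 0") auto
      qed
    qed (use xy in auto)
    then show "dist (g x) (g y) \<le> L * dist x y" by (simp add: dist_norm)
  qed fact
qed

end

section \<open>The Hessian matrix as a quadratic form on matrices\<close>

lemma norm_matrix_entries: "norm (\<chi> i j. v $ (i, j)) = norm v" for v :: "real ^ ('m::finite \<times> 'n::finite)"
  by (simp add: norm_eq_sqrt_inner inner_vec_def sum.cartesian_product UNIV_Times_UNIV[symmetric] del: UNIV_Times_UNIV)

lemma matrix_unit_sum: "(\<chi> i j. v $ (i, j)) = (\<Sum>p\<in>UNIV. v $ p *\<^sub>R unit_matrix p)" for v :: "real ^ ('m::finite \<times> 'n::finite)"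
proof -
  have "(\<Sum>p\<in>UNIV. v $ p *\<^sub>R unit_matrix p) $ i $ j = v $ (i, j)" for i j
  proof -
    have "(\<Sum>p\<in>UNIV. v $ p *\<^sub>R unit_matrix p) $ i $ j = (\<Sum>p\<in>UNIV. if p = (i, j) then v $ p else 0)"
      unfolding sum_component by (rule sum.cong) (auto simp: unit_matrix_def axis_def)
    then show ?thesis by simp
  qed
  then show ?thesis by (simp add: vec_eq_iff)
qed

locale matrix_twice_derivative = twice_derivative f f' f''
  for f :: "real ^ 'n ^ 'm \<Rightarrow> real" and f' f'' +
  assumes cont: "continuous_on UNIV (\<lambda>x. f'' x v w)"
begin

lemma transpose_hessian: "transpose (hessian f A) = hessian f A"
  by (simp add: transpose_def hessian_def frechet_D2_eq vec_eq_iff sym)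

lemma hessian_quadratic:
  fixes v :: "real ^ ('m \<times> 'n)"
  defines "B \<equiv> \<chi> i j. v $ (i, j)"
  shows "v \<bullet> (hessian f A *v v) = f'' A B B"
proof -
  have "f'' A B B = (\<Sum>p\<in>UNIV. v $ p * (\<Sum>q\<in>UNIV. v $ q * f'' A (unit_matrix q) (unit_matrix p)))"
    unfolding B_def matrix_unit_sum
    by (simp add: linear_sum[OF linear_left] linear_sum[OF linear_right] linear_cmul[OF linear_left] linear_cmul[OF linear_right])
  then show ?thesis
    by (simp add: inner_vec_def matrix_vector_mult_def hessian_def frechet_D2_eq mult.commute)
      (intro sum.cong refl arg_cong2[where f = "(*)"] sym)
qed

text \<open>The maximum is taken jointly over matrices in the ball and unit vectors, where
  continuity of the entries suffices, and at a maximizer it is squeezed to \<open>m A0\<close>.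
  Continuity of eigenvalues in the matrix is thereby avoided.\<close>

lemma smoothness_on_D_ball:
  assumes M: "M > 0" and K: "\<And>x v. \<bar>f'' x v v\<bar> \<le> K * (norm v)\<^sup>2"
  defines "m \<equiv> \<lambda>A. max (lambda_max (hessian f A)) (- lambda_min (hessian f A))"
  shows "\<exists>L. (\<exists>A\<in>D_ball M. L = m A) \<and> (\<forall>A\<in>D_ball M. m A \<le> L) \<and> L_smooth_on L (D_ball M) f \<and> L \<le> K"
proof -
  have ball: "D_ball M = cball 0 (M / 2)" by (auto simp: D_ball_def)
  let ?S = "D_ball M \<times> sphere (0 :: real ^ ('m \<times> 'n)) 1"
  let ?q = "\<lambda>(A, v). \<bar>v \<bullet> (hessian f A *v v)\<bar>"
  have entry: "continuous_on ?S (\<lambda>x. f'' (fst x) (unit_matrix p) (unit_matrix q))" for p q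
    by (rule continuous_on_compose2[OF cont]) (auto intro: continuous_intros)
  have "continuous_on ?S (\<lambda>x. \<bar>\<Sum>p\<in>UNIV. snd x $ p * (\<Sum>q\<in>UNIV. f'' (fst x) (unit_matrix p) (unit_matrix q) * snd x $ q)\<bar>)"
    by (intro continuous_intros entry)
  then have "continuous_on ?S ?q"
    by (simp add: case_prod_unfold inner_vec_def matrix_vector_mult_def hessian_def frechet_D2_eq)
  moreover have "compact ?S" unfolding ball by (intro compact_Times compact_cball compact_sphere)
  moreover have "?S \<noteq> {}" using M by (auto simp: D_ball_def intro!: exI[of _ 0])
  ultimately obtain z where z: "z \<in> ?S" and max: "\<And>y. y \<in> ?S \<Longrightarrow> ?q y \<le> ?q z"
    using continuous_attains_sup[of ?S ?q] by blast
  obtain A0 v0 where zz: "z = (A0, v0)" by (cases z)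
  define L where "L = ?q z"
  have Lle: "\<bar>v \<bullet> (hessian f A *v v)\<bar> \<le> L" if "A \<in> D_ball M" "norm v = 1" for A v
    using max[of "(A, v)"] that by (simp add: L_def)
  have m_le: "m A \<le> L" if "A \<in> D_ball M" for A
    using spectral_radius_rayleigh(2)[OF transpose_hessian, of A] Lle[OF that] unfolding m_def by metis
  have "L \<le> m A0"
    using spectral_radius_rayleigh(1)[OF transpose_hessian, of v0 A0] z by (simp add: L_def zz m_def)
  then have eq: "L = m A0" using m_le[of A0] z zz by auto
  have quad: "\<bar>f'' A B B\<bar> \<le> L * (norm B)\<^sup>2" if A: "A \<in> D_ball M" for A B
  proof -
    define v :: "real ^ ('m \<times> 'n)" where "v = (\<chi> p. B $ fst p $ snd p)"
    have B: "B = (\<chi> i j. v $ (i, j))" by (simp add: v_def vec_eq_iff)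
    have "\<bar>v \<bullet> (hessian f A *v v)\<bar> \<le> m A * (norm v)\<^sup>2"
      unfolding m_def by (rule spectral_radius_rayleigh(1)[OF transpose_hessian])
    also have "\<dots> \<le> L * (norm v)\<^sup>2" by (intro mult_right_mono m_le A) simp
    finally show ?thesis unfolding hessian_quadratic B[symmetric] by (simp add: B norm_matrix_entries)
  qed
  have "L \<le> K"
  proof -
    have "norm v0 = 1" using z zz by simp
    then show ?thesis
      using K[of A0 "\<chi> i j. v0 $ (i, j)"] by (simp add: L_def zz hessian_quadratic norm_matrix_entries)
  qed
  moreover have "L_smooth_on L (D_ball M) f"
    by (rule L_smooth_onI[OF _ quad]) (auto simp: ball, simp add: L_def zz)
  ultimately show ?thesis using eq m_le z zz by auto
qed

end

section \<open>Strictly convex coercive functions\<close>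

text \<open>The squared norm of a convex combination falls short of the combination of squared norms
  by \<open>t * (1 - t) * (norm (x - y))\<^sup>2\<close>; times \<open>\<rho> / 2 < 0\<close> this
  is the strict gain.\<close>

lemma strictly_convexI:
  fixes f :: "'a::real_inner \<Rightarrow> real"
  assumes f: "weakly_convex \<rho> f" and "\<rho> < 0" shows "strictly_convex f"
  unfolding strictly_convex_def
proof (intro allI impI, elim conjE)
  fix x y :: 'a and t :: real assume xy: "x \<noteq> y" and t: "0 < t" "t < 1"
  define z where "z = (1 - t) *\<^sub>R x + t *\<^sub>R y"
  have "f z + \<rho> / 2 * (norm z)\<^sup>2 \<le> (1 - t) * (f x + \<rho> / 2 * (norm x)\<^sup>2) + t * (f y + \<rho> / 2 * (norm y)\<^sup>2)"
    using f t unfolding weakly_convex_def convex_on_def z_def by auto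
  moreover have "(norm z)\<^sup>2 = (1 - t) * (norm x)\<^sup>2 + t * (norm y)\<^sup>2 - t * (1 - t) * (norm (x - y))\<^sup>2"
    unfolding z_def power2_norm_eq_inner
    by (simp add: inner_left_distrib inner_right_distrib inner_diff_left inner_diff_right inner_commute algebra_simps)
  ultimately have "f z \<le> (1 - t) * f x + t * f y + \<rho> / 2 * (t * (1 - t) * (norm (x - y))\<^sup>2)"
    by (simp add: field_simps)
  moreover have "\<rho> / 2 * (t * (1 - t) * (norm (x - y))\<^sup>2) < 0"
    using \<open>\<rho> < 0\<close> t xy by (intro mult_neg_pos mult_pos_pos) auto
  ultimately show "f ((1 - t) *\<^sub>R x + t *\<^sub>R y) < (1 - t) * f x + t * f y" unfolding z_def[symmetric] by linarith
qed

lemma strictly_convex_minimizer: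
  fixes f :: "'a::euclidean_space \<Rightarrow> real"
  assumes f: "continuous_on UNIV f" "strictly_convex f"
    and coercive: "\<And>x. a * (norm x)\<^sup>2 - b * norm x - c \<le> f x" and a: "a > 0"
  shows "\<exists>!x. \<forall>y. f x \<le> f y"
proof (rule ex_ex1I)
  \<comment> \<open>Beyond \<open>R\<close> the function is at least \<open>f 0\<close>:
    \<open>a * R\<close> dominates the three constants, and \<open>R \<ge> 1\<close> lets
    \<open>\<bar>c\<bar>\<close> and \<open>\<bar>f 0\<bar>\<close> be replaced by their multiples
    with \<open>norm y\<close>.\<close>
  define R where "R = max 1 ((\<bar>b\<bar> + \<bar>c\<bar> + \<bar>f 0\<bar>) / a)"
  have R: "R \<ge> 1" "a * R \<ge> \<bar>b\<bar> + \<bar>c\<bar> + \<bar>f 0\<bar>" using a by (auto simp: R_def max_def field_simps)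
  obtain x where x: "x \<in> cball 0 R" "\<And>y. y \<in> cball 0 R \<Longrightarrow> f x \<le> f y"
    using continuous_attains_inf[OF compact_cball, of 0 R f] continuous_on_subset[OF f(1)] R(1) by auto
  have "f x \<le> f y" for y
  proof (cases "y \<in> cball 0 R")
    case False
    then have y: "R \<le> norm y" by simp
    have "\<bar>b\<bar> + \<bar>c\<bar> + \<bar>f 0\<bar> \<le> a * norm y"
      using R(2) mult_left_mono[OF y, of a] a by linarith
    then have "(\<bar>b\<bar> + \<bar>c\<bar> + \<bar>f 0\<bar>) * norm y \<le> a * (norm y)\<^sup>2"
      by (simp add: power2_eq_square mult_right_mono flip: mult.assoc)
    moreover have "b * norm y \<le> \<bar>b\<bar> * norm y" by (simp add: mult_right_mono)
    moreover have "\<bar>c\<bar> * 1 \<le> \<bar>c\<bar> * norm y" "\<bar>f 0\<bar> * 1 \<le> \<bar>f 0\<bar> * norm y"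
      using y R by (intro mult_left_mono; simp)+
    ultimately have "f 0 \<le> f y" using coercive[of y] by (simp add: algebra_simps)
    then show ?thesis using x(2)[of 0] R(1) by simp
  qed (use x in auto)
  then show "\<exists>x. \<forall>y. f x \<le> f y" by blast
next
  fix x y assume xy: "\<forall>z. f x \<le> f z" "\<forall>z. f y \<le> f z"
  show "x = y"
  proof (rule ccontr)
    assume "x \<noteq> y"
    then have "f ((1 - 1/2) *\<^sub>R x + (1/2) *\<^sub>R y) < (1 - 1/2) * f x + (1/2) * f y"
      by (intro f(2)[unfolded strictly_convex_def, rule_format]) simp
    moreover have "f x = f y" using xy by (meson order_antisym)
    ultimately show False using xy(1)[rule_format, of "(1 - 1/2) *\<^sub>R x + (1/2) *\<^sub>R y"] by simp
  qed
qed

section \<open>The entropic transport problem\<close>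

text \<open>The complement of the support is a union of open null sets, and by the Lindeloef
  property countably many of them cover it.\<close>

lemma AE_measure_supp:
  fixes \<mu> :: "'a::second_countable_topology measure"
  assumes "borel_probability \<mu>" shows "AE x in \<mu>. x \<in> measure_supp \<mu>"
proof -
  have sets: "sets \<mu> = sets borel" using assms by (simp add: borel_probability_def)
  let ?F = "{U. open U \<and> emeasure \<mu> U = 0}"
  obtain F' where F': "F' \<subseteq> ?F" "countable F'" "\<Union>F' = \<Union>?F"
    by (rule Lindelof[of ?F]) auto
  have "(\<Union>U\<in>F'. U) \<in> null_sets \<mu>"
    by (rule null_sets_UN'[OF F'(2)]) (use F'(1) in \<open>auto simp: null_sets_def sets\<close>)
  then have "\<Union>?F \<in> null_sets \<mu>" using F'(3) by simp
  moreover have "{x \<in> space \<mu>. x \<notin> measure_supp \<mu>} \<subseteq> \<Union>?F"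
    by (auto simp: measure_supp_def not_gr_zero)
  ultimately show ?thesis by (rule AE_I')
qed

lemma (in two_markov) gibbs_mean_cauchy_schwarz:
  "gibbs_mean f (u \<odot> v) \<le> sqrt (gibbs_mean f (u \<odot> u) * gibbs_mean f (v \<odot> v))"
proof -
  let ?A = "gibbs_mean f (u \<odot> u)" and ?B = "gibbs_mean f (u \<odot> v)" and ?C = "gibbs_mean f (v \<odot> v)"
  have A: "0 \<le> ?A" and C: "0 \<le> ?C" by (intro gibbs_mean_nonneg; simp)+
  have q: "0 \<le> t\<^sup>2 * ?A - 2 * t * ?B + ?C" for t
  proof -
    have "(t *\<^sub>R u - v) \<odot> (t *\<^sub>R u - v) = t\<^sup>2 *\<^sub>R (u \<odot> u) - (2 * t) *\<^sub>R (u \<odot> v) + v \<odot> v"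
      by (rule bcontfun_eqI) (simp add: power2_eq_square algebra_simps)
    moreover have "0 \<le> gibbs_mean f ((t *\<^sub>R u - v) \<odot> (t *\<^sub>R u - v))" by (rule gibbs_mean_nonneg) simp
    ultimately show ?thesis
      by (simp add: linear_add[OF linear_gibbs_mean] linear_diff[OF linear_gibbs_mean] linear_cmul[OF linear_gibbs_mean])
  qed
  have "?B\<^sup>2 \<le> ?A * ?C"
  proof (cases "?A = 0")
    case True
    have "?B = 0"
    proof (rule ccontr)
      assume "?B \<noteq> 0"
      \<comment> \<open>The leading coefficient vanishes, so the polynomial is affine in
        \<open>t\<close>; at this point its value is -1.\<close>
      then show False using q[of "(?C + 1) / (2 * ?B)"] True by simp
    qed
    then show ?thesis using True by simp
  next
    case False
    then show ?thesis using q[of "?B / ?A"] A by (simp add: power2_eq_square field_simps)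
  qed
  then show ?thesis by (rule real_le_rsqrt)
qed

lemma norm_matrix_vector_le: "norm (A *v y) \<le> norm A * norm y" for A :: "real ^ 'n ^ 'm"
proof -
  have "(norm (A *v y))\<^sup>2 = (\<Sum>i\<in>UNIV. (A $ i \<bullet> y)\<^sup>2)"
    unfolding power2_norm_eq_inner inner_vec_def[of "A *v y"]
    by (simp add: matrix_vector_mul_component power2_eq_square)
  also have "\<dots> \<le> (\<Sum>i\<in>UNIV. (norm (A $ i))\<^sup>2 * (norm y)\<^sup>2)"
    by (intro sum_mono) (metis Cauchy_Schwarz_ineq2 abs_le_square_iff abs_mult abs_norm_cancel power_mult_distrib)
  also have "\<dots> = (norm A * norm y)\<^sup>2"
    by (simp add: power_mult_distrib power2_norm_eq_inner[of A] inner_vec_def[of A] power2_norm_eq_inner[of "A $ _"] sum_distrib_right)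
  finally show ?thesis by (rule power2_le_imp_le) simp
qed

section \<open>The truncated cost\<close>

locale bounded_marginals = two_marginals \<mu>0 \<mu>1
  for \<mu>0 :: "(real ^ 'd0) measure" and \<mu>1 :: "(real ^ 'd1) measure" +
  fixes R \<epsilon> :: real
  assumes R: "R \<ge> 0" and AE0: "AE x in \<mu>0. norm x \<le> R" and AE1: "AE y in \<mu>1. norm y \<le> R"
    and \<epsilon>: "\<epsilon> > 0"
begin

text \<open>The cost is unbounded, so it is truncated outside the ball of radius \<^term>\<open>R\<close>; this does not
  affect integrals against couplings.\<close>

definition trunc :: "'a::euclidean_space \<Rightarrow> 'a" where "trunc = closest_point (cball 0 R)"

lemma norm_trunc: "norm (trunc x) \<le> R"
  using closest_point_in_set[of "cball 0 R" x] R by (simp add: trunc_def)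

lemma trunc_id: "norm x \<le> R \<Longrightarrow> trunc x = x"
  by (simp add: trunc_def closest_point_self)

lemma continuous_on_trunc [continuous_intros]: "continuous_on S g \<Longrightarrow> continuous_on S (\<lambda>x. trunc (g x))"
  using continuous_on_compose2[OF continuous_on_closest_point[of "cball 0 R" UNIV]] R
  by (auto simp: trunc_def)

definition sq0 :: "((real ^ 'd0) \<times> (real ^ 'd1)) \<Rightarrow>\<^sub>C real"
  where "sq0 = Bcontfun (\<lambda>(x, y). (norm (trunc x))\<^sup>2)"

definition sq1 :: "((real ^ 'd0) \<times> (real ^ 'd1)) \<Rightarrow>\<^sub>C real"
  where "sq1 = Bcontfun (\<lambda>(x, y). (norm (trunc y))\<^sup>2)"

definition bil :: "real ^ 'd1 ^ 'd0 \<Rightarrow> (((real ^ 'd0) \<times> (real ^ 'd1)) \<Rightarrow>\<^sub>C real)"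
  where "bil A = Bcontfun (\<lambda>(x, y). 32 / \<epsilon> * (trunc x \<bullet> (A *v trunc y)))"

lemma apply_sq0 [simp]: "sq0 (x, y) = (norm (trunc x))\<^sup>2"
proof -
  have "apply_bcontfun sq0 = (\<lambda>(x, y). (norm (trunc x))\<^sup>2)"
    unfolding sq0_def case_prod_unfold
    by (rule apply_Bcontfun[of _ "R\<^sup>2"]) (auto intro!: continuous_intros power_mono norm_trunc)
  then show ?thesis by simp
qed

lemma apply_sq1 [simp]: "sq1 (x, y) = (norm (trunc y))\<^sup>2"
proof -
  have "apply_bcontfun sq1 = (\<lambda>(x, y). (norm (trunc y))\<^sup>2)"
    unfolding sq1_def case_prod_unfold
    by (rule apply_Bcontfun[of _ "R\<^sup>2"]) (auto intro!: continuous_intros power_mono norm_trunc)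
  then show ?thesis by simp
qed

lemma abs_bilinear_le: "\<bar>x \<bullet> (A *v y)\<bar> \<le> norm A * (norm x * norm y)"
  for A :: "real ^ 'd1 ^ 'd0"
proof -
  have "\<bar>x \<bullet> (A *v y)\<bar> \<le> norm x * norm (A *v y)" by (rule Cauchy_Schwarz_ineq2)
  also have "\<dots> \<le> norm x * (norm A * norm y)" by (intro mult_left_mono norm_matrix_vector_le) simp
  finally show ?thesis by (simp add: mult_ac)
qed

lemma abs_bil_le: "\<bar>32 / \<epsilon> * (trunc x \<bullet> (A *v trunc y))\<bar> \<le> norm A * (32 / \<epsilon> * (R * R))"
  for A :: "real ^ 'd1 ^ 'd0"
proof -
  have "\<bar>trunc x \<bullet> (A *v trunc y)\<bar> \<le> norm A * (norm (trunc x) * norm (trunc y))" by (rule abs_bilinear_le)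
  also have "\<dots> \<le> norm A * (R * R)" by (intro mult_left_mono mult_mono norm_trunc R) auto
  finally have "32 / \<epsilon> * \<bar>trunc x \<bullet> (A *v trunc y)\<bar> \<le> 32 / \<epsilon> * (norm A * (R * R))"
    using \<epsilon> by (intro mult_left_mono) auto
  then show ?thesis using \<epsilon> by (simp add: abs_mult mult_ac)
qed

lemma apply_bil [simp]: "bil A (x, y) = 32 / \<epsilon> * (trunc x \<bullet> (A *v trunc y))"
proof -
  have "apply_bcontfun (bil A) = (\<lambda>(x, y). 32 / \<epsilon> * (trunc x \<bullet> (A *v trunc y)))"
    unfolding bil_def case_prod_unfold
    by (rule apply_Bcontfun[OF _ abs_bil_le])
       (intro continuous_intros bounded_linear.continuous_on[OF matrix_vector_mul_bounded_linear])
  then show ?thesis by simp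
qed

lemma bounded_linear_bil: "bounded_linear bil"
proof (rule bounded_linear_intro)
  show "bil (A + B) = bil A + bil B" for A B
    by (rule bcontfun_eqI, safe) (simp add: matrix_vector_mult_add_rdistrib inner_right_distrib algebra_simps)
  show "bil (c *\<^sub>R A) = c *\<^sub>R bil A" for c A
    by (rule bcontfun_eqI, safe) (simp add: scaleR_matrix_vector_assoc[symmetric])
  show "norm (bil A) \<le> norm A * (32 / \<epsilon> * (R * R))" for A
    by (rule norm_bcontfun_le, safe) (simp only: apply_bil abs_bil_le)
qed

text \<open>The truncated cost divided by \<open>- \<epsilon>\<close>, affine in \<open>A\<close>
  with linear part \<open>bil\<close>. The factors \<open>sq0\<close> and \<open>sq1\<close> stay
  separate because each depends on one variable only, which the moment bound exploits.\<close>

definition pay :: "real ^ 'd1 ^ 'd0 \<Rightarrow> (((real ^ 'd0) \<times> (real ^ 'd1)) \<Rightarrow>\<^sub>C real)"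
  where "pay A = (4 / \<epsilon>) *\<^sub>R (sq0 \<odot> sq1) + bil A"

lemma integral_cost:
  assumes \<pi>: "\<pi> \<in> couplings \<mu>0 \<mu>1"
  shows "(\<integral>z. cost A z \<partial>\<pi>) = - \<epsilon> * (\<integral>z. pay A z \<partial>\<pi>)"
proof -
  have s: "sets \<pi> = sets borel" using coupling_prob[OF \<pi>] sets_prod by simp
  have "(\<integral>z. cost A z \<partial>\<pi>) = (\<integral>z. - \<epsilon> * pay A z \<partial>\<pi>)"
  proof (rule integral_cong_AE)
    have "continuous_on UNIV (cost A)"
      unfolding cost_def case_prod_unfold
      by (intro continuous_intros bounded_linear.continuous_on[OF matrix_vector_mul_bounded_linear])
    then show "cost A \<in> borel_measurable \<pi>"
      unfolding measurable_cong_sets[OF s refl] by (rule borel_measurable_continuous_onI)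
    show "(\<lambda>z. - \<epsilon> * pay A z) \<in> borel_measurable \<pi>"
      unfolding measurable_cong_sets[OF s refl] by (intro borel_measurable_continuous_onI continuous_intros)
    show "AE z in \<pi>. cost A z = - \<epsilon> * pay A z"
      using coupling_AE(1)[OF \<pi> AE0] coupling_AE(2)[OF \<pi> AE1]
    proof eventually_elim
      case (elim z)
      then show ?case using \<epsilon> by (cases z) (simp add: cost_def pay_def trunc_id field_simps)
    qed
  qed
  then show ?thesis by simp
qed

text \<open>The Gibbs coupling gives the upper bound; \<open>KL_ext_ge\<close> gives the lower one
  and also covers couplings of infinite divergence.\<close>

lemma entropic_OT_eq: "entropic_OT \<epsilon> \<mu>0 \<mu>1 A = ereal (- \<epsilon> * markov.free_energy (pay A))"
proof (rule antisym)
  let ?\<gamma> = "density (\<mu>0 \<Otimes>\<^sub>M \<mu>1) (\<lambda>z. ennreal (markov.gibbs (pay A) z))"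
  have \<gamma>: "?\<gamma> \<in> couplings \<mu>0 \<mu>1" by (rule gibbs_coupling)
  have "entropic_OT \<epsilon> \<mu>0 \<mu>1 A \<le> ereal (\<integral>z. cost A z \<partial>?\<gamma>) + ereal \<epsilon> * KL_ext ?\<gamma> (\<mu>0 \<Otimes>\<^sub>M \<mu>1)"
    unfolding entropic_OT_def by (rule INF_lower[OF \<gamma>])
  also have "\<dots> = ereal (- \<epsilon> * markov.free_energy (pay A))"
    unfolding integral_cost[OF \<gamma>] gibbs_coupling(2) by (simp add: algebra_simps)
  finally show "entropic_OT \<epsilon> \<mu>0 \<mu>1 A \<le> ereal (- \<epsilon> * markov.free_energy (pay A))" .
  show "ereal (- \<epsilon> * markov.free_energy (pay A)) \<le> entropic_OT \<epsilon> \<mu>0 \<mu>1 A"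
    unfolding entropic_OT_def
  proof (rule INF_greatest)
    fix \<pi> assume \<pi>: "\<pi> \<in> couplings \<mu>0 \<mu>1"
    have "ereal \<epsilon> * ereal ((\<integral>z. pay A z \<partial>\<pi>) - markov.free_energy (pay A)) \<le> ereal \<epsilon> * KL_ext \<pi> (\<mu>0 \<Otimes>\<^sub>M \<mu>1)"
      using \<epsilon> by (intro ereal_mult_left_mono KL_ext_ge[OF \<pi>]) simp
    then have "ereal (\<integral>z. cost A z \<partial>\<pi>) + ereal \<epsilon> * ereal ((\<integral>z. pay A z \<partial>\<pi>) - markov.free_energy (pay A))
        \<le> ereal (\<integral>z. cost A z \<partial>\<pi>) + ereal \<epsilon> * KL_ext \<pi> (\<mu>0 \<Otimes>\<^sub>M \<mu>1)"
      by (rule add_left_mono)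
    moreover have "ereal (\<integral>z. cost A z \<partial>\<pi>) + ereal \<epsilon> * ereal ((\<integral>z. pay A z \<partial>\<pi>) - markov.free_energy (pay A))
        = ereal (- \<epsilon> * markov.free_energy (pay A))"
      unfolding integral_cost[OF \<pi>] by (simp add: algebra_simps)
    ultimately show "ereal (- \<epsilon> * markov.free_energy (pay A))
        \<le> ereal (\<integral>z. cost A z \<partial>\<pi>) + ereal \<epsilon> * KL_ext \<pi> (\<mu>0 \<Otimes>\<^sub>M \<mu>1)" by (simp only:)
  qed
qed

lemma Phi_eq: "Phi \<epsilon> \<mu>0 \<mu>1 A = 32 * (A \<bullet> A) - \<epsilon> * markov.free_energy (pay A)"
  by (simp add: Phi_def entropic_OT_eq power2_norm_eq_inner)

section \<open>Derivatives of the objective and curvature bounds\<close>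

definition Phi' :: "real ^ 'd1 ^ 'd0 \<Rightarrow> real ^ 'd1 ^ 'd0 \<Rightarrow> real"
  where "Phi' A B = 64 * (A \<bullet> B) - \<epsilon> * markov.gibbs_mean (pay A) (bil B)"

definition Phi'' :: "real ^ 'd1 ^ 'd0 \<Rightarrow> real ^ 'd1 ^ 'd0 \<Rightarrow> real ^ 'd1 ^ 'd0 \<Rightarrow> real"
  where "Phi'' A B C = 64 * (B \<bullet> C) - \<epsilon> * markov.gibbs_cov (pay A) (bil B) (bil C)"

lemma has_derivative_pay: "(pay has_derivative bil) (at A)"
proof -
  have "((\<lambda>A. (4 / \<epsilon>) *\<^sub>R (sq0 \<odot> sq1) + bil A) has_derivative (\<lambda>B. 0 + bil B)) (at A)"
    by (intro derivative_intros bounded_linear_imp_has_derivative bounded_linear_bil)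
  then show ?thesis by (simp add: pay_def[abs_def])
qed

lemma continuous_on_pay [continuous_intros]: "continuous_on S pay"
  by (auto intro!: continuous_at_imp_continuous_on has_derivative_continuous[OF has_derivative_pay])

sublocale Phi: matrix_twice_derivative "Phi \<epsilon> \<mu>0 \<mu>1" Phi' Phi''
proof
  fix A B C :: "real ^ 'd1 ^ 'd0"
  have "((\<lambda>A. 32 * (A \<bullet> A) - \<epsilon> * markov.free_energy (pay A)) has_derivative
      (\<lambda>B. 32 * (A \<bullet> B + B \<bullet> A) - \<epsilon> * markov.gibbs_mean (pay A) (bil B))) (at A)"
    by (intro derivative_intros has_derivative_compose[OF has_derivative_pay markov.has_derivative_free_energy])
  then show "(Phi \<epsilon> \<mu>0 \<mu>1 has_derivative Phi' A) (at A)"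
    unfolding Phi_eq[abs_def] by (rule has_derivative_eq_rhs) (auto simp: Phi'_def inner_commute)
  have "((\<lambda>A. 64 * (A \<bullet> C) - \<epsilon> * markov.gibbs_mean (pay A) (bil C)) has_derivative
      (\<lambda>B. 64 * (B \<bullet> C) - \<epsilon> * markov.gibbs_cov (pay A) (bil B) (bil C))) (at A)"
    by (intro has_derivative_diff has_derivative_mult_right
        bounded_linear_imp_has_derivative[OF bounded_linear_inner_left]
        has_derivative_compose[OF has_derivative_pay markov.has_derivative_gibbs_mean])
  then show "((\<lambda>A. Phi' A C) has_derivative (\<lambda>B. Phi'' A B C)) (at A)"
    by (simp add: Phi'_def Phi''_def)
  show "Phi'' A B C = Phi'' A C B"
    by (simp add: Phi''_def inner_commute markov.gibbs_cov_commute)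
  show "continuous_on UNIV (\<lambda>A. Phi'' A B C)"
    unfolding Phi''_def by (intro continuous_intros)
qed

text \<open>A multiple of \<open>sq0 \<odot> sq1\<close> dominates
  \<open>bil B \<odot> bil B\<close> pointwise, and Cauchy-Schwarz separates its factors. Each
  squared factor depends on one variable, so its Gibbs mean is a fourth moment of a marginal,
  whatever \<open>f\<close> is.\<close>

lemma gibbs_mean_bil_le:
  "\<epsilon> * markov.gibbs_mean f (bil B \<odot> bil B)
    \<le> 32\<^sup>2 / \<epsilon> * sqrt (abs_moment 4 \<mu>0 * abs_moment 4 \<mu>1) * (norm B)\<^sup>2"
proof -
  have m0: "markov.gibbs_mean f (sq0 \<odot> sq0) = abs_moment 4 \<mu>0"
  proof -
    have "fst_only (sq0 \<odot> sq0)" by (simp add: fst_only_def)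
    then have "markov.gibbs_mean f (sq0 \<odot> sq0) = (\<integral>x. (sq0 \<odot> sq0) (x, undefined) \<partial>\<mu>0)"
      by (simp only: markov.gibbs_mean_def markov.E_gibbs_fst_only E_fst_only)
    also have "\<dots> = (\<integral>x. norm x ^ 4 \<partial>\<mu>0)"
    proof (rule integral_cong_AE)
      show "(\<lambda>x. (sq0 \<odot> sq0) (x, undefined)) \<in> borel_measurable \<mu>0" by (rule measurable_section)
      show "(\<lambda>x. norm x ^ 4) \<in> borel_measurable \<mu>0"
        unfolding measurable_cong_sets[OF sets_\<mu> refl] by simp
      show "AE x in \<mu>0. (sq0 \<odot> sq0) (x, undefined) = norm x ^ 4"
        using AE0 by eventually_elim (simp add: trunc_id power2_eq_square power4_eq_xxxx)
    qed
    finally show ?thesis by (simp add: abs_moment_def)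
  qed
  have m1: "markov.gibbs_mean f (sq1 \<odot> sq1) = abs_moment 4 \<mu>1"
  proof -
    have "snd_only (sq1 \<odot> sq1)" by (simp add: snd_only_def)
    then have "markov.gibbs_mean f (sq1 \<odot> sq1) = (\<integral>y. (sq1 \<odot> sq1) (undefined, y) \<partial>\<mu>1)"
      by (simp only: markov.gibbs_mean_def markov.E_gibbs_snd_only E_snd_only)
    also have "\<dots> = (\<integral>x. norm x ^ 4 \<partial>\<mu>1)"
    proof (rule integral_cong_AE)
      show "(\<lambda>y. (sq1 \<odot> sq1) (undefined, y)) \<in> borel_measurable \<mu>1" by (rule measurable_section)
      show "(\<lambda>x. norm x ^ 4) \<in> borel_measurable \<mu>1"
        unfolding measurable_cong_sets[OF sets_\<nu> refl] by simp
      show "AE x in \<mu>1. (sq1 \<odot> sq1) (undefined, x) = norm x ^ 4"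
        using AE1 by eventually_elim (simp add: trunc_id power2_eq_square power4_eq_xxxx)
    qed
    finally show ?thesis by (simp add: abs_moment_def)
  qed
  let ?c = "(32 / \<epsilon>)\<^sup>2 * (norm B)\<^sup>2"
  have "0 \<le> markov.gibbs_mean f (?c *\<^sub>R (sq0 \<odot> sq1) - bil B \<odot> bil B)"
  proof (rule markov.gibbs_mean_nonneg, safe)
    fix x y
    have "\<bar>trunc x \<bullet> (B *v trunc y)\<bar> \<le> \<bar>norm B * (norm (trunc x) * norm (trunc y))\<bar>"
      using abs_bilinear_le[of "trunc x" B "trunc y"] by simp
    then have "(trunc x \<bullet> (B *v trunc y))\<^sup>2 \<le> (norm B * (norm (trunc x) * norm (trunc y)))\<^sup>2"
      by (rule abs_le_square_iff[THEN iffD1])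
    then have "(32 / \<epsilon>)\<^sup>2 * (trunc x \<bullet> (B *v trunc y))\<^sup>2 \<le> (32 / \<epsilon>)\<^sup>2 * (norm B * (norm (trunc x) * norm (trunc y)))\<^sup>2"
      by (rule mult_left_mono) simp
    moreover have "(bil B \<odot> bil B) (x, y) = (32 / \<epsilon>)\<^sup>2 * (trunc x \<bullet> (B *v trunc y))\<^sup>2"
      by (simp add: power2_eq_square)
    ultimately show "0 \<le> (?c *\<^sub>R (sq0 \<odot> sq1) - bil B \<odot> bil B) (x, y)"
      by (simp add: power_mult_distrib mult_ac)
  qed
  then have "markov.gibbs_mean f (bil B \<odot> bil B) \<le> ?c * markov.gibbs_mean f (sq0 \<odot> sq1)"
    by (simp add: linear_diff[OF markov.linear_gibbs_mean] linear_cmul[OF markov.linear_gibbs_mean])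
  also have "\<dots> \<le> ?c * sqrt (abs_moment 4 \<mu>0 * abs_moment 4 \<mu>1)"
    using markov.gibbs_mean_cauchy_schwarz[of f sq0 sq1] unfolding m0 m1 by (intro mult_left_mono) auto
  finally have "\<epsilon> * markov.gibbs_mean f (bil B \<odot> bil B) \<le> \<epsilon> * (?c * sqrt (abs_moment 4 \<mu>0 * abs_moment 4 \<mu>1))"
    using \<epsilon> by (intro mult_left_mono) auto
  also have "\<dots> = 32\<^sup>2 / \<epsilon> * sqrt (abs_moment 4 \<mu>0 * abs_moment 4 \<mu>1) * (norm B)\<^sup>2"
    using \<epsilon> by (simp add: power2_eq_square)
  finally show ?thesis .
qed

abbreviation "\<rho> \<equiv> 32\<^sup>2 / \<epsilon> * sqrt (abs_moment 4 \<mu>0 * abs_moment 4 \<mu>1) - 64"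

lemma Phi''_bounds: "- \<rho> * (norm B)\<^sup>2 \<le> Phi'' A B B" "Phi'' A B B \<le> 64 * (norm B)\<^sup>2"
proof -
  have "\<epsilon> * markov.gibbs_cov (pay A) (bil B) (bil B) \<le> \<epsilon> * markov.gibbs_mean (pay A) (bil B \<odot> bil B)"
    using \<epsilon> by (intro mult_left_mono markov.gibbs_cov_le) simp
  also note gibbs_mean_bil_le
  finally show "- \<rho> * (norm B)\<^sup>2 \<le> Phi'' A B B"
    by (simp add: Phi''_def power2_norm_eq_inner left_diff_distrib)
  show "Phi'' A B B \<le> 64 * (norm B)\<^sup>2"
    using mult_nonneg_nonneg[OF less_imp_le[OF \<epsilon>] markov.gibbs_cov_nonneg[of "pay A" "bil B"]]
    by (simp add: Phi''_def power2_norm_eq_inner)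
qed

lemma abs_Phi''_le: "\<bar>Phi'' A B B\<bar> \<le> max 64 \<rho> * (norm B)\<^sup>2"
proof -
  have "64 * (norm B)\<^sup>2 \<le> max 64 \<rho> * (norm B)\<^sup>2" "\<rho> * (norm B)\<^sup>2 \<le> max 64 \<rho> * (norm B)\<^sup>2"
    by (intro mult_right_mono; simp)+
  then show ?thesis using Phi''_bounds(1)[of B A] Phi''_bounds(2)[of A B] by linarith
qed

lemma Phi_weakly_convex: "weakly_convex \<rho> (Phi \<epsilon> \<mu>0 \<mu>1)"
  by (rule Phi.weakly_convexI) (rule Phi''_bounds)

text \<open>The free energy is at most the norm of the payoff, which grows at most linearly in
  \<open>A\<close>, so the quadratic term prevails.\<close>

lemma Phi_coercive: "\<exists>b c. \<forall>A. 32 * (norm A)\<^sup>2 - b * norm A - c \<le> Phi \<epsilon> \<mu>0 \<mu>1 A"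
proof -
  obtain K where K: "\<And>A. norm (bil A) \<le> norm A * K" using bounded_linear.bounded[OF bounded_linear_bil] by blast
  let ?a = "norm ((4 / \<epsilon>) *\<^sub>R (sq0 \<odot> sq1))"
  have "32 * (norm A)\<^sup>2 - (\<epsilon> * K) * norm A - \<epsilon> * ?a \<le> Phi \<epsilon> \<mu>0 \<mu>1 A" for A
  proof -
    have "markov.free_energy (pay A) \<le> norm (pay A)" by (rule markov.free_energy_le)
    also have "\<dots> \<le> ?a + norm A * K" unfolding pay_def by (rule norm_triangle_le) (use K[of A] in simp)
    finally have "\<epsilon> * markov.free_energy (pay A) \<le> \<epsilon> * (?a + norm A * K)" using \<epsilon> by (intro mult_left_mono) auto
    then show ?thesis by (simp add: Phi_eq power2_norm_eq_inner algebra_simps)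
  qed
  then show ?thesis by blast
qed

lemma Phi_unique_minimizer:
  assumes "sqrt (abs_moment 4 \<mu>0 * abs_moment 4 \<mu>1) < \<epsilon> / 16"
  shows "strictly_convex (Phi \<epsilon> \<mu>0 \<mu>1) \<and> (\<exists>!A. \<forall>B. Phi \<epsilon> \<mu>0 \<mu>1 A \<le> Phi \<epsilon> \<mu>0 \<mu>1 B)"
proof
  have "\<rho> < 0" using assms \<epsilon> by (simp add: field_simps)
  with Phi_weakly_convex show sc: "strictly_convex (Phi \<epsilon> \<mu>0 \<mu>1)" by (rule strictly_convexI)
  obtain b c where bc: "\<And>A. 32 * (norm A)\<^sup>2 - b * norm A - c \<le> Phi \<epsilon> \<mu>0 \<mu>1 A" using Phi_coercive by blast
  have "continuous_on UNIV (Phi \<epsilon> \<mu>0 \<mu>1)"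
    by (auto intro!: continuous_at_imp_continuous_on has_derivative_continuous[OF Phi.d1])
  then show "\<exists>!A. \<forall>B. Phi \<epsilon> \<mu>0 \<mu>1 A \<le> Phi \<epsilon> \<mu>0 \<mu>1 B"
    using sc bc by (rule strictly_convex_minimizer) simp
qed

end

text \<open>Two conjuncts guard against default values: finiteness ensures that
  \<open>real_of_ereal\<close> in \<open>Phi\<close> returns the actual transport cost, and twice
  differentiability that \<open>hessian\<close> consists of genuine second derivatives. The matrix
  attaining \<open>L\<close> makes it a maximum over the ball.\<close>

theorem theorem6:
  fixes \<mu>0 :: "(real ^ 'd0) measure" and \<mu>1 :: "(real ^ 'd1) measure" and \<epsilon> :: real
  assumes "borel_probability \<mu>0" and "compactly_supported \<mu>0"
    and "borel_probability \<mu>1" and "compactly_supported \<mu>1"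
    and "\<epsilon> > 0"
  shows "(\<forall>A. \<bar>entropic_OT \<epsilon> \<mu>0 \<mu>1 A\<bar> \<noteq> \<infinity>)
    \<and> weakly_convex (32\<^sup>2 / \<epsilon> * sqrt (abs_moment 4 \<mu>0 * abs_moment 4 \<mu>1) - 64) (Phi \<epsilon> \<mu>0 \<mu>1)
    \<and> (sqrt (abs_moment 4 \<mu>0 * abs_moment 4 \<mu>1) < \<epsilon> / 16 \<longrightarrow>
        strictly_convex (Phi \<epsilon> \<mu>0 \<mu>1) \<and> (\<exists>!A. \<forall>B. Phi \<epsilon> \<mu>0 \<mu>1 A \<le> Phi \<epsilon> \<mu>0 \<mu>1 B))
    \<and> (\<forall>A. twice_frechet_differentiable_at (Phi \<epsilon> \<mu>0 \<mu>1) A)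
    \<and> (\<forall>M>0. \<exists>L.
        (\<exists>A\<in>D_ball M. L = max (lambda_max (hessian (Phi \<epsilon> \<mu>0 \<mu>1) A))
                               (- lambda_min (hessian (Phi \<epsilon> \<mu>0 \<mu>1) A)))
        \<and> (\<forall>A\<in>D_ball M. max (lambda_max (hessian (Phi \<epsilon> \<mu>0 \<mu>1) A))
                               (- lambda_min (hessian (Phi \<epsilon> \<mu>0 \<mu>1) A)) \<le> L)
        \<and> L_smooth_on L (D_ball M) (Phi \<epsilon> \<mu>0 \<mu>1)
        \<and> L \<le> max 64 (32\<^sup>2 / \<epsilon> * sqrt (abs_moment 4 \<mu>0 * abs_moment 4 \<mu>1) - 64))"
proof -
  have "bounded (measure_supp \<mu>0)" "bounded (measure_supp \<mu>1)"
    using assms(2,4) by (simp_all add: compactly_supported_def compact_imp_bounded)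
  then obtain R0 R1 where R0: "\<forall>x\<in>measure_supp \<mu>0. norm x \<le> R0" and R1: "\<forall>y\<in>measure_supp \<mu>1. norm y \<le> R1"
    by (auto simp: bounded_iff)
  define R where "R = max 0 (max R0 R1)"
  have p: "prob_space \<mu>0" "prob_space \<mu>1" "sets \<mu>0 = sets borel" "sets \<mu>1 = sets borel"
    using assms by (auto simp: borel_probability_def)
  interpret pair_prob_space \<mu>0 \<mu>1
    using p(1,2) by (intro pair_prob_space.intro pair_sigma_finite.intro prob_space_imp_sigma_finite)
  interpret bounded_marginals \<mu>0 \<mu>1 R \<epsilon>
  proof
    show "AE x in \<mu>0. norm x \<le> R"
      using AE_measure_supp[OF assms(1)] by eventually_elim (use R0 in \<open>simp add: R_def le_max_iff_disj\<close>)
    show "AE x in \<mu>1. norm x \<le> R"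
      using AE_measure_supp[OF assms(3)] by eventually_elim (use R1 in \<open>simp add: R_def le_max_iff_disj\<close>)
  qed (use p assms(5) in \<open>simp_all add: R_def\<close>)
  show ?thesis
  proof (intro conjI)
    show "\<forall>A. \<bar>entropic_OT \<epsilon> \<mu>0 \<mu>1 A\<bar> \<noteq> \<infinity>"
      by (simp add: entropic_OT_eq)
    show "weakly_convex (32\<^sup>2 / \<epsilon> * sqrt (abs_moment 4 \<mu>0 * abs_moment 4 \<mu>1) - 64) (Phi \<epsilon> \<mu>0 \<mu>1)"
      by (rule Phi_weakly_convex)
    show "\<forall>A. twice_frechet_differentiable_at (Phi \<epsilon> \<mu>0 \<mu>1) A"
      by (intro allI Phi.twice_frechet_differentiable)
  qed (intro allI impI; rule Phi_unique_minimizer Phi.smoothness_on_D_ball[OF _ abs_Phi''_le]; assumption)+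
qed

end
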